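(* Let $K$ be an infinite field, $S=K[x_1,\ldots,x_n]$, and let $I\subset S$ be a proper squarefree monomial ideal. Then $$\operatorname{depth}(S/I)\leq \operatorname{hdepth}(S/I)\leq \dim(S/I)\leq n-1,$$ where $\operatorname{hdepth}$ denotes the Hilbert depth.
   Context: $S$ has the standard grading. For a finitely generated graded $S$-module $M$, $H_M(t)=\sum_{j\ge 0}(\dim_K M_j)t^j$ is its Hilbert series. The Hilbert depth $\operatorname{hdepth}(M)$ is the maximal $r$ such that there exists a finitely generated graded $S$-module $N$ with $H_N(t)=H_M(t)$ and $\operatorname{depth}(N)=r$. By a theorem of Uliczka, $\operatorname{hdepth}(M)$ is equivalently the maximal $r$ such that all coefficients of the power series $(1-t)^rH_M(t)$ are nonnegative. For squarefree monomial ideals $I\subsetneq J\subseteq S$ and $[n]=\{1,\ldots,n\}$, put $\alpha_j(J/I)=|\{A\subseteq[n] : |A|=j,\ \prod_{i\in A}x_i\in J\setminus I\}|$ and $\beta_k^q(J/I)=\sum_{j=0}^k(-1)^{k-j}\binom{q-j}{k-j}\alpha_j(J/I)$. Then, equivalently (a previously known result), $\operatorname{hdepth}(J/I)=\max\{q : 0\le q\le n,\ \beta_k^q(J/I)\ge 0\text{ for all }0\le k\le q\}$. $\operatorname{depth}$ is the depth with respect to the graded maximal ideal $(x_1,\ldots,x_n)$, and $\dim$ is the Krull dimension.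
   Formalization: The inequality dim(S/I) ≤ n−1 is stated only for I ≠ 0 (for I = 0 one has dim S = n) and n ≥ 1; the modules N in the Hilbert depth are taken on sets of sequences of polynomials, which reaches every finitely generated module up to isomorphism. *)

theory Defs
  imports
    "HOL-Algebra.Algebra"
    "HOL-Algebra.Algebraic_Closure_Type"
    "HOL-Computational_Algebra.Formal_Power_Series"
    "HOL-Library.Poly_Mapping"
    "HOL-Library.Extended_Nat"
    "Jordan_Normal_Form.Missing_VectorSpace"
begin

section \<open>The polynomial ring\<close>

text \<open>
  The variables of \<open>K[x\<^sub>1, \<dots>, x\<^sub>n]\<close> are indexed by a finite type \<open>'n\<close>, so \<open>n = card (UNIV :: 'n set)\<close>; a polynomial
  maps exponent vectors \<open>'n \<Rightarrow>\<^sub>0 nat\<close> to coefficients.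
\<close>

type_synonym ('k, 'n) mpoly = "('n \<Rightarrow>\<^sub>0 nat) \<Rightarrow>\<^sub>0 'k"

abbreviation mpoly_ring :: "('k::field, 'n::finite) mpoly ring"
  where "mpoly_ring \<equiv> ring_of_type_algebra"

definition var :: "'n::finite \<Rightarrow> ('k::field, 'n) mpoly"
  where "var i = Poly_Mapping.single (Poly_Mapping.single i 1) 1"

definition const :: "'k::field \<Rightarrow> ('k, 'n::finite) mpoly"
  where "const c = Poly_Mapping.single 0 c"

definition homogeneous :: "nat \<Rightarrow> ('k::field, 'n::finite) mpoly set"
  where "homogeneous d =
    {p. \<forall>a\<in>Poly_Mapping.keys p. (\<Sum>i\<in>UNIV. Poly_Mapping.lookup a i) = d}"

definition max_ideal :: "('k::field, 'n::finite) mpoly set"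
  where "max_ideal = Idl\<^bsub>mpoly_ring\<^esub> (range var)"

definition squarefree_monomial_ideal :: "('k::field, 'n::finite) mpoly set \<Rightarrow> bool"
  where "squarefree_monomial_ideal I \<longleftrightarrow>
    (\<exists>F :: 'n set set. I = Idl\<^bsub>mpoly_ring\<^esub> ((\<lambda>A. \<Prod>i\<in>A. var i) ` F))"

section \<open>Krull dimension\<close>

definition krull_dim :: "('a, 'b) ring_scheme \<Rightarrow> enat"
  where "krull_dim R =
    Sup {enat k | k. \<exists>P. (\<forall>i\<le>k. primeideal (P i) R) \<and> (\<forall>i<k. P i \<subset> P (Suc i))}"

section \<open>Depth\<close>

text \<open>
  The library has two locales \<open>module\<close>; the qualified names below all refer to modules over
  \<open>HOL-Algebra\<close> rings.  The multiplication and unit fields of a \<open>module\<close> record are not used.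
\<close>

definition finitely_generated ::
    "(('k::field, 'n::finite) mpoly, 'm) module \<Rightarrow> bool"
  where "finitely_generated M \<longleftrightarrow>
    (\<exists>A. finite A \<and> A \<subseteq> carrier M \<and>
         LinearCombinations.module.span mpoly_ring M A = carrier M)"

text \<open>For a set \<open>A\<close> of polynomials, \<open>ideal_smult A M\<close> is the submodule \<open>(A)M\<close>.\<close>

definition ideal_smult ::
    "('k::field, 'n::finite) mpoly set \<Rightarrow> (('k, 'n) mpoly, 'm) module \<Rightarrow> 'm set"
  where "ideal_smult A M =
    LinearCombinations.module.span mpoly_ring M {a \<odot>\<^bsub>M\<^esub> v | a v. a \<in> A \<and> v \<in> carrier M}"

text \<open>
  The first conjunct says that \<open>xs ! i\<close> is a nonzerodivisor on \<open>M / (xs ! 0, \<dots>, xs ! (i-1))M\<close>.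
\<close>

definition regular_sequence ::
    "(('k::field, 'n::finite) mpoly, 'm) module \<Rightarrow> ('k, 'n) mpoly list \<Rightarrow> bool"
  where "regular_sequence M xs \<longleftrightarrow>
    (\<forall>i<length xs. \<forall>v\<in>carrier M.
        (xs ! i) \<odot>\<^bsub>M\<^esub> v \<in> ideal_smult (set (take i xs)) M \<longrightarrow>
        v \<in> ideal_smult (set (take i xs)) M) \<and>
    ideal_smult (set xs) M \<noteq> carrier M"

definition depth :: "(('k::field, 'n::finite) mpoly, 'm) module \<Rightarrow> enat"
  where "depth M = Sup {enat (length xs) | xs. set xs \<subseteq> max_ideal \<and> regular_sequence M xs}"

section \<open>Graded modules and Hilbert depth\<close>

definition graded_module ::
    "(('k::field, 'n::finite) mpoly, 'm) module \<Rightarrow> (nat \<Rightarrow> 'm set) \<Rightarrow> bool"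
  where "graded_module M G \<longleftrightarrow>
    Module.module mpoly_ring M \<and>
    (\<forall>j. subgroup (G j) (add_monoid M)) \<and>
    (\<forall>v\<in>carrier M. \<exists>!f. (\<forall>j. f j \<in> G j) \<and> finite {j. f j \<noteq> \<zero>\<^bsub>M\<^esub>} \<and>
        v = (\<Oplus>\<^bsub>M\<^esub>j\<in>{j. f j \<noteq> \<zero>\<^bsub>M\<^esub>}. f j)) \<and>
    (\<forall>i j. \<forall>p\<in>homogeneous i. \<forall>v\<in>G j. p \<odot>\<^bsub>M\<^esub> v \<in> G (i + j))"

definition component_space ::
    "(('k::field, 'n::finite) mpoly, 'm) module \<Rightarrow> 'm set \<Rightarrow> ('k, 'm) module"
  where "component_space M V =
    \<lparr>carrier = V, monoid.mult = (\<otimes>\<^bsub>M\<^esub>), one = \<one>\<^bsub>M\<^esub>, ring.zero = \<zero>\<^bsub>M\<^esub>, add = (\<oplus>\<^bsub>M\<^esub>),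
     module.smult = (\<lambda>c v. const c \<odot>\<^bsub>M\<^esub> v)\<rparr>"

text \<open>
  \<open>vectorspace.dim\<close> is only meaningful in finite dimension, which holds for the graded components
  of a finitely generated graded module.
\<close>

definition hilbert_series ::
    "(('k::field, 'n::finite) mpoly, 'm) module \<Rightarrow> (nat \<Rightarrow> 'm set) \<Rightarrow> nat fps"
  where "hilbert_series M G =
    Abs_fps (\<lambda>j. vectorspace.dim (ring_of_type_algebra :: 'k ring) (component_space M (G j)))"

text \<open>
  The competing modules \<open>N\<close> must live in one fixed type.  A finitely generated module is isomorphic
  to a quotient \<open>S\<^sup>k / U\<close> of a free module over the polynomial ring \<open>S\<close>; its elements are cosets,
  that is, sets of functions \<open>nat \<Rightarrow> S\<close> supported on \<open>{..<k}\<close>.  Letting \<open>N\<close> range over all modules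
  with carrier in \<open>(nat \<Rightarrow> S) set\<close> thus reaches every isomorphism class.
\<close>

definition hdepth ::
    "(('k::field, 'n::finite) mpoly, 'm) module \<Rightarrow> (nat \<Rightarrow> 'm set) \<Rightarrow> enat"
  where "hdepth M G =
    Sup {depth N | (N :: (('k, 'n) mpoly, (nat \<Rightarrow> ('k, 'n) mpoly) set) module) H.
           graded_module N H \<and> finitely_generated N \<and> hilbert_series N H = hilbert_series M G}"

section \<open>Quotients of the polynomial ring as graded modules\<close>

definition quot_module ::
    "('k::field, 'n::finite) mpoly set \<Rightarrow> (('k, 'n) mpoly, ('k, 'n) mpoly set) module"
  where "quot_module I = (let Q = mpoly_ring Quot I in
    \<lparr>carrier = carrier Q, monoid.mult = (\<otimes>\<^bsub>Q\<^esub>), one = \<one>\<^bsub>Q\<^esub>, ring.zero = \<zero>\<^bsub>Q\<^esub>, add = (\<oplus>\<^bsub>Q\<^esub>),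
     module.smult = (\<lambda>p C. (I +>\<^bsub>mpoly_ring\<^esub> p) \<otimes>\<^bsub>Q\<^esub> C)\<rparr>)"

definition quot_grading ::
    "('k::field, 'n::finite) mpoly set \<Rightarrow> nat \<Rightarrow> ('k, 'n) mpoly set set"
  where "quot_grading I j = (\<lambda>p. I +>\<^bsub>mpoly_ring\<^esub> p) ` homogeneous j"

end

theory Submission
  imports Defs
begin

text \<open>
  Let \<open>d\<close> be the largest size of a set \<open>A\<close> of variables with \<open>\<Prod>i\<in>A. x\<^sub>i \<notin> I\<close>.  All dimensions are compared with \<open>d\<close>.

  Let \<open>U\<^sub>0 \<subseteq> \<dots> \<subseteq> U\<^sub>r\<close> be submodules of \<open>M\<close> and \<open>f\<^sub>1, \<dots>, f\<^sub>r\<close> polynomials such that \<open>f\<^sub>i\<close> is a nonzerodivisor modulo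
  \<open>U\<^bsub>i-1\<^esub>\<close> and maps \<open>M\<close> into \<open>U\<^sub>i\<close>.  If \<open>v \<notin> U\<^sub>r\<close>, then the elements \<open>f\<^sup>a v\<close> are linearly independent: group a linear
  relation by powers of \<open>f\<^sub>1\<close>, cancel the lowest power and look at the result modulo \<open>U\<^sub>1\<close>.  Hence the
  Hilbert function of \<open>M\<close>, summed up to degree \<open>J\<close>, grows at least like \<open>J\<^sup>r\<close>, even if the \<open>f\<^sub>i\<close> are
  not homogeneous; in the lemmas below the indices of \<open>f\<close> start at \<open>0\<close>.  Both a regular sequence on \<open>M\<close> (with \<open>U\<^sub>i = (f\<^sub>1, \<dots>, f\<^sub>i)M\<close>) and a chain of primes of
  \<open>S/I\<close> (with \<open>U\<^sub>i\<close> the primes and \<open>f\<^sub>i \<in> U\<^sub>i - U\<^bsub>i-1\<^esub>\<close>) are of this form.  The summed Hilbert function of \<open>S/I\<close> is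
  at most \<open>2\<^sup>n (J + 1)\<^sup>d\<close>, so \<open>d\<close> bounds the depth of every competing module and the Krull dimension.  The
  primes \<open>(x\<^sub>i : i \<notin> A)\<close> give a chain of length \<open>d\<close>, and \<open>d < n\<close> unless \<open>I = 0\<close>.
\<close>

section \<open>Linear independence of powers\<close>

lemma ring_of_type_algebra_simps [simp]:
  "carrier ring_of_type_algebra = UNIV"
  "x \<otimes>\<^bsub>ring_of_type_algebra\<^esub> y = x * y"
  "x \<oplus>\<^bsub>ring_of_type_algebra\<^esub> y = x + y"
  "\<one>\<^bsub>ring_of_type_algebra\<^esub> = 1"
  "\<zero>\<^bsub>ring_of_type_algebra\<^esub> = 0"
  by (simp_all add: ring_of_type_algebra_def)

lemma const_simps [simp]:
  "const 0 = 0" "const 1 = 1" "const (a + b) = const a + const b" "const (a * b) = const a * const b"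
  by (simp_all add: const_def single_add mult_single)

lemma component_space_simps [simp]:
  "carrier (component_space M V) = V"
  "\<zero>\<^bsub>component_space M V\<^esub> = \<zero>\<^bsub>M\<^esub>"
  "x \<oplus>\<^bsub>component_space M V\<^esub> y = x \<oplus>\<^bsub>M\<^esub> y"
  "c \<odot>\<^bsub>component_space M V\<^esub> x = const c \<odot>\<^bsub>M\<^esub> x"
  by (simp_all add: component_space_def)

lemma finsum_component_space [simp]:
  "finsum (component_space M (carrier M)) f A = finsum M f A"
  by (simp add: finsum_def finprod_def component_space_def)

text \<open>Library facts on subspaces phrase them as a carrier update of the ambient module. This
  brings that form back to \<open>component_space\<close>.\<close>

lemma component_space_update [simp]:
  "component_space M W\<lparr>carrier := V\<rparr> = component_space M V"
  by (simp add: component_space_def)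

locale poly_module = Module.module mpoly_ring M
  for M :: "(('k::field, 'n::finite) mpoly, 'm) module" (structure)
begin

text \<open>Restriction of scalars along \<open>const\<close>; it makes dimension arguments
  available for modules over the polynomial ring.\<close>

lemma vectorspace_restrict: "vectorspace (ring_of_type_algebra :: 'k ring) (component_space M (carrier M))"
proof (rule vectorspace.intro)
  show "field (ring_of_type_algebra :: 'k ring)" by (rule field_from_type_algebra)
  then interpret K: field "ring_of_type_algebra :: 'k ring" .
  show "Module.module (ring_of_type_algebra :: 'k ring) (component_space M (carrier M))"
  proof (rule module_criteria)
    show "\<forall>v\<in>carrier (component_space M (carrier M)). \<exists>neg_v\<in>carrier (component_space M (carrier M)).
      v \<oplus>\<^bsub>component_space M (carrier M)\<^esub> neg_v = \<zero>\<^bsub>component_space M (carrier M)\<^esub>"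
      by (auto intro!: bexI[of _ "\<ominus>\<^bsub>M\<^esub> _"] simp: M.r_neg)
  next
    show "\<forall>v\<in>carrier (component_space M (carrier M)). \<one>\<^bsub>ring_of_type_algebra\<^esub> \<odot>\<^bsub>component_space M (carrier M)\<^esub> v = v"
      using smult_one by simp
  qed (use smult_closed smult_one smult_l_distr smult_r_distr smult_assoc1 in
      \<open>auto simp: K.is_cring M.a_ac\<close>)
qed

sublocale KV: vectorspace "ring_of_type_algebra :: 'k ring" "component_space M (carrier M)"
  by (rule vectorspace_restrict)

lemma smult_simps [simp]:
  "v \<in> carrier M \<Longrightarrow> p \<odot>\<^bsub>M\<^esub> v \<in> carrier M"
  "v \<in> carrier M \<Longrightarrow> 1 \<odot>\<^bsub>M\<^esub> v = v"
  "v \<in> carrier M \<Longrightarrow> 0 \<odot>\<^bsub>M\<^esub> v = \<zero>\<^bsub>M\<^esub>"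
  "p \<odot>\<^bsub>M\<^esub> \<zero>\<^bsub>M\<^esub> = \<zero>\<^bsub>M\<^esub>"
  using smult_closed[of p v] smult_one[of v] smult_l_null[of v] smult_r_null[of p] by auto

lemma smult_add_left: "v \<in> carrier M \<Longrightarrow> (p + q) \<odot>\<^bsub>M\<^esub> v = p \<odot>\<^bsub>M\<^esub> v \<oplus>\<^bsub>M\<^esub> q \<odot>\<^bsub>M\<^esub> v"
  using smult_l_distr[of p q v] by simp

lemma smult_add_right:
  "v \<in> carrier M \<Longrightarrow> w \<in> carrier M \<Longrightarrow> p \<odot>\<^bsub>M\<^esub> (v \<oplus>\<^bsub>M\<^esub> w) = p \<odot>\<^bsub>M\<^esub> v \<oplus>\<^bsub>M\<^esub> p \<odot>\<^bsub>M\<^esub> w"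
  using smult_r_distr[of p v w] by simp

lemma smult_mult: "v \<in> carrier M \<Longrightarrow> (p * q) \<odot>\<^bsub>M\<^esub> v = p \<odot>\<^bsub>M\<^esub> (q \<odot>\<^bsub>M\<^esub> v)"
  using smult_assoc1[of p q v] by simp

lemma smult_sum:
  "finite A \<Longrightarrow> v \<in> carrier M \<Longrightarrow> (\<Sum>a\<in>A. p a) \<odot>\<^bsub>M\<^esub> v = (\<Oplus>\<^bsub>M\<^esub>a\<in>A. p a \<odot>\<^bsub>M\<^esub> v)"
  by (induction A rule: finite_induct) (auto simp: smult_add_left)

abbreviation kspan :: "'m set \<Rightarrow> 'm set"
  where "kspan \<equiv> LinearCombinations.module.span (ring_of_type_algebra :: 'k ring) (component_space M (carrier M))"

lemma ksubspaceI:
  assumes "V \<subseteq> carrier M" "\<zero>\<^bsub>M\<^esub> \<in> V" "\<And>v w. v \<in> V \<Longrightarrow> w \<in> V \<Longrightarrow> v \<oplus>\<^bsub>M\<^esub> w \<in> V"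
    "\<And>c v. v \<in> V \<Longrightarrow> const c \<odot>\<^bsub>M\<^esub> v \<in> V"
  shows "submodule (ring_of_type_algebra :: 'k ring) V (component_space M (carrier M))"
  using assms KV.module_axioms by unfold_locales auto

lemma submoduleI:
  assumes "V \<subseteq> carrier M" "\<zero>\<^bsub>M\<^esub> \<in> V" "\<And>v w. v \<in> V \<Longrightarrow> w \<in> V \<Longrightarrow> v \<oplus>\<^bsub>M\<^esub> w \<in> V"
    "\<And>c v. v \<in> V \<Longrightarrow> c \<odot>\<^bsub>M\<^esub> v \<in> V"
  shows "submodule mpoly_ring V M"
  using assms module_axioms by unfold_locales auto

lemma kspan_simps:
  assumes "S \<subseteq> carrier M"
  shows "\<zero>\<^bsub>M\<^esub> \<in> kspan S" "v \<in> kspan S \<Longrightarrow> w \<in> kspan S \<Longrightarrow> v \<oplus>\<^bsub>M\<^esub> w \<in> kspan S"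
    "v \<in> kspan S \<Longrightarrow> const c \<odot>\<^bsub>M\<^esub> v \<in> kspan S" "kspan S \<subseteq> carrier M" "S \<subseteq> kspan S"
proof -
  have S: "S \<subseteq> carrier (component_space M (carrier M))" using assms by simp
  interpret submodule "ring_of_type_algebra :: 'k ring" "kspan S" "component_space M (carrier M)"
    by (rule KV.span_is_submodule[OF S])
  show "\<zero>\<^bsub>M\<^esub> \<in> kspan S" "v \<in> kspan S \<Longrightarrow> w \<in> kspan S \<Longrightarrow> v \<oplus>\<^bsub>M\<^esub> w \<in> kspan S"
    "v \<in> kspan S \<Longrightarrow> const c \<odot>\<^bsub>M\<^esub> v \<in> kspan S" "kspan S \<subseteq> carrier M"
    using zero_closed m_closed[of v w] smult_closed[of c v] subset by auto
  show "S \<subseteq> kspan S" by (rule KV.in_own_span[OF S])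
qed

lemma kspan_least:
  assumes "V \<subseteq> carrier M" "\<zero>\<^bsub>M\<^esub> \<in> V" "\<And>v w. v \<in> V \<Longrightarrow> w \<in> V \<Longrightarrow> v \<oplus>\<^bsub>M\<^esub> w \<in> V"
    "\<And>c v. v \<in> V \<Longrightarrow> const c \<odot>\<^bsub>M\<^esub> v \<in> V" and "S \<subseteq> V"
  shows "kspan S \<subseteq> V"
  by (rule KV.span_is_subset[OF assms(5) ksubspaceI[OF assms(1-4)]])

section \<open>Products of powers along a chain of submodules\<close>

abbreviation box :: "nat \<Rightarrow> nat \<Rightarrow> nat list set"
  where "box r m \<equiv> {a. set a \<subseteq> {..m} \<and> length a = r}"

text \<open>Exponents are lists, so that splitting off the first entry goes together with the shift
  of the chain by one step in the induction below.\<close>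

definition mpow :: "(nat \<Rightarrow> ('k, 'n) mpoly) \<Rightarrow> nat list \<Rightarrow> ('k, 'n) mpoly"
  where "mpow f a = (\<Prod>i<length a. f i ^ (a ! i))"

lemma box_Suc: "box (Suc r) m = (\<lambda>(k, a). k # a) ` ({..m} \<times> box r m)"
  by (auto simp: length_Suc_conv image_def)

lemma mpow_Nil [simp]: "mpow f [] = 1" and mpow_Cons [simp]: "mpow f (k # a) = f 0 ^ k * mpow (\<lambda>i. f (Suc i)) a"
  by (simp_all add: mpow_def prod.lessThan_Suc_shift del: prod.lessThan_Suc)

lemma finite_box: "finite (box r m)"
  using finite_lists_length_eq[of "{..m}" r] by simp

text \<open>The relation is only required to hold modulo \<open>U 0\<close>, not exactly: the
  induction on \<open>r\<close> passes to the shifted chain, where the remaining relation is known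
  only modulo \<open>U 1\<close>.\<close>

lemma mpow_independent:
  assumes "\<And>i. i \<le> r \<Longrightarrow> submodule mpoly_ring (U i) M"
    and "\<And>i. i < r \<Longrightarrow> U i \<subseteq> U (Suc i)"
    and "\<And>i w. i < r \<Longrightarrow> w \<in> carrier M \<Longrightarrow> f i \<odot>\<^bsub>M\<^esub> w \<in> U i \<Longrightarrow> w \<in> U i"
    and "\<And>i w. i < r \<Longrightarrow> w \<in> carrier M \<Longrightarrow> f i \<odot>\<^bsub>M\<^esub> w \<in> U (Suc i)"
    and "v \<in> carrier M" "v \<notin> U r"
    and "(\<Sum>a\<in>box r m. const (c a) * mpow f a) \<odot>\<^bsub>M\<^esub> v \<in> U 0"
  shows "\<forall>a\<in>box r m. c a = 0"
  using assms
proof (induction r arbitrary: U f c)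
  case 0
  have "box 0 m = {[]}" by auto
  then have c0: "const (c []) \<odot>\<^bsub>M\<^esub> v \<in> U 0" using "0.prems"(7) by simp
  interpret submodule mpoly_ring "U 0" M using "0.prems"(1)[of 0] by simp
  have False if "c [] \<noteq> 0"
  proof -
    have "const (inverse (c [])) \<odot>\<^bsub>M\<^esub> (const (c []) \<odot>\<^bsub>M\<^esub> v) \<in> U 0" using c0 smult_closed by simp
    moreover have "const (inverse (c [])) * const (c []) = (1 :: ('k, 'n) mpoly)"
      using that const_simps(4)[of "inverse (c [])" "c []"] by simp
    ultimately show False using \<open>v \<in> carrier M\<close> \<open>v \<notin> U 0\<close> smult_mult[OF \<open>v \<in> carrier M\<close>, of "const (inverse (c []))" "const (c [])"]
      by simp
  qed
  then show ?case by auto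
next
  case (Suc r)
  note v = \<open>v \<in> carrier M\<close>
  let ?f' = "\<lambda>i. f (Suc i)"
  \<comment> \<open>\<open>w k\<close> is the coefficient of \<open>f 0 ^ k\<close> after grouping
    the relation by powers of \<open>f 0\<close>.\<close>
  define w where "w k = (\<Sum>a\<in>box r m. const (c (k # a)) * mpow ?f' a)" for k
  have sum_eq: "(\<Sum>a\<in>box (Suc r) m. const (c a) * mpow f a) = (\<Sum>k\<le>m. f 0 ^ k * w k)"
    unfolding box_Suc w_def sum_distrib_left
    by (subst sum.reindex) (auto simp: inj_on_def sum.cartesian_product mult_ac intro!: sum.cong)
  have U: "submodule mpoly_ring (U 0) M" "submodule mpoly_ring (U 1) M" using Suc.prems(1)[of 0] Suc.prems(1)[of 1] by auto
  \<comment> \<open>Strong induction on the first exponent: once the coefficients for smaller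
    exponents vanish, \<open>f 0 ^ k\<close> divides the whole relation.\<close>
  have "\<forall>a\<in>box r m. c (k # a) = 0" if "k \<le> m" for k
    using that
  proof (induction k rule: less_induct)
    case (less k)
    have w0: "w j = 0" if "j < k" for j
      unfolding w_def using less.IH[OF that] less.prems that by (intro sum.neutral) auto
    \<comment> \<open>The terms with exponent above \<open>k\<close> amount to
      \<open>f 0 ^ k * (f 0 * q)\<close>.\<close>
    define q where "q = (\<Sum>j\<in>{k<..m}. f 0 ^ (j - Suc k) * w j)"
    have "(\<Sum>j\<le>m. f 0 ^ j * w j) = (\<Sum>j\<in>{k..m}. f 0 ^ j * w j)"
      using w0 by (intro sum.mono_neutral_right) auto
    also have "\<dots> = f 0 ^ k * w k + (\<Sum>j\<in>{k<..m}. f 0 ^ j * w j)"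
      using less.prems by (simp add: sum.head)
    also have "(\<Sum>j\<in>{k<..m}. f 0 ^ j * w j) = f 0 ^ k * (f 0 * q)"
      unfolding q_def sum_distrib_left
    proof (rule sum.cong)
      fix j assume "j \<in> {k<..m}"
      then have "j = k + Suc (j - Suc k)" by auto
      then have "f 0 ^ j = f 0 ^ k * f 0 * f 0 ^ (j - Suc k)" by (metis power_add power_Suc mult.assoc)
      then show "f 0 ^ j * w j = f 0 ^ k * (f 0 * (f 0 ^ (j - Suc k) * w j))" by (simp add: mult_ac)
    qed simp
    finally have *: "(f 0 ^ k * (w k + f 0 * q)) \<odot>\<^bsub>M\<^esub> v \<in> U 0"
      using Suc.prems(7) sum_eq by (simp add: distrib_left)
    \<comment> \<open>\<open>f 0\<close> is a nonzerodivisor modulo \<open>U 0\<close>, hence so are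
      its powers.\<close>
    have cancel: "y \<in> U 0" if "y \<in> carrier M" "(f 0 ^ l) \<odot>\<^bsub>M\<^esub> y \<in> U 0" for l y
      using that
    proof (induction l)
      case (Suc l)
      then show ?case using Suc.prems Suc.IH assms smult_mult[of y "f 0" "f 0 ^ l"]
          \<open>\<And>i w. i < Suc r \<Longrightarrow> w \<in> carrier M \<Longrightarrow> f i \<odot>\<^bsub>M\<^esub> w \<in> U i \<Longrightarrow> w \<in> U i\<close>[of 0 "(f 0 ^ l) \<odot>\<^bsub>M\<^esub> y"] by simp
    qed simp
    have "(w k + f 0 * q) \<odot>\<^bsub>M\<^esub> v \<in> U 0"
      by (rule cancel[of _ k]) (use * v in \<open>simp_all only: smult_simps smult_mult\<close>)
    then have "(w k + f 0 * q) \<odot>\<^bsub>M\<^esub> v \<in> U 1" using Suc.prems(2)[of 0] by auto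
    \<comment> \<open>\<open>f 0\<close> maps the module into \<open>U 1\<close>, so the higher
      terms disappear modulo \<open>U 1\<close> and only \<open>w k\<close> is left.\<close>
    moreover have "(f 0 * q) \<odot>\<^bsub>M\<^esub> v \<in> U 1"
      using Suc.prems(4)[of 0 "q \<odot>\<^bsub>M\<^esub> v"] v by (simp add: smult_mult)
    then have "(- 1) \<odot>\<^bsub>M\<^esub> ((f 0 * q) \<odot>\<^bsub>M\<^esub> v) \<in> U 1"
      using submodule.smult_closed[OF U(2)] by simp
    ultimately have "(w k + f 0 * q) \<odot>\<^bsub>M\<^esub> v \<oplus>\<^bsub>M\<^esub> (- 1) \<odot>\<^bsub>M\<^esub> ((f 0 * q) \<odot>\<^bsub>M\<^esub> v) \<in> U 1"
      using submodule.m_closed[OF U(2)] by simp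
    also have "(w k + f 0 * q) \<odot>\<^bsub>M\<^esub> v \<oplus>\<^bsub>M\<^esub> (- 1) \<odot>\<^bsub>M\<^esub> ((f 0 * q) \<odot>\<^bsub>M\<^esub> v) = (w k + f 0 * q + (- 1) * (f 0 * q)) \<odot>\<^bsub>M\<^esub> v"
      by (simp only: smult_add_left[OF v, of "w k + f 0 * q"] smult_mult[OF v, of "- 1"])
    also have "w k + f 0 * q + (- 1) * (f 0 * q) = w k" by simp
    finally have "(\<Sum>a\<in>box r m. const (c (k # a)) * mpow ?f' a) \<odot>\<^bsub>M\<^esub> v \<in> U (Suc 0)"
      by (simp add: w_def)
    note wk = this
    show ?case
    proof (rule Suc.IH[of "\<lambda>i. U (Suc i)" ?f' "\<lambda>a. c (k # a)"])
      show "submodule mpoly_ring (U (Suc i)) M" if "i \<le> r" for i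
        using Suc.prems(1)[of "Suc i"] that by simp
      show "U (Suc i) \<subseteq> U (Suc (Suc i))" if "i < r" for i
        using Suc.prems(2)[of "Suc i"] that by simp
      show "w \<in> U (Suc i)" if "i < r" "w \<in> carrier M" "f (Suc i) \<odot>\<^bsub>M\<^esub> w \<in> U (Suc i)" for i w
        by (rule Suc.prems(3)[of "Suc i"]) (use that in auto)
      show "f (Suc i) \<odot>\<^bsub>M\<^esub> w \<in> U (Suc (Suc i))" if "i < r" "w \<in> carrier M" for i w
        by (rule Suc.prems(4)[of "Suc i"]) (use that in auto)
    qed (use wk Suc.prems(5,6) in simp_all)
  qed
  then show ?case unfolding box_Suc by auto
qed

end

section \<open>Growth along regular chains\<close>

definition mdeg :: "('n::finite \<Rightarrow>\<^sub>0 nat) \<Rightarrow> nat"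
  where "mdeg a = (\<Sum>i\<in>UNIV. Poly_Mapping.lookup a i)"

lemma mdeg_0 [simp]: "mdeg 0 = 0" and mdeg_add: "mdeg (a + b) = mdeg a + mdeg b"
  by (simp_all add: mdeg_def lookup_add sum.distrib)

lemma homogeneous_iff: "p \<in> homogeneous d \<longleftrightarrow> (\<forall>a\<in>Poly_Mapping.keys p. mdeg a = d)"
  by (simp add: homogeneous_def mdeg_def)

lemma single_homogeneous: "Poly_Mapping.single a c \<in> homogeneous (mdeg a)"
  by (auto simp: homogeneous_iff split: if_splits)

lemma const_homogeneous: "const c \<in> homogeneous 0"
  using single_homogeneous[of 0 c] by (simp add: const_def)

text \<open>A filtration by degree takes the place of the grading, because the polynomials attached
  to a chain may be inhomogeneous.\<close>

definition polys_upto :: "nat \<Rightarrow> ('k::field, 'n::finite) mpoly set"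
  where "polys_upto d = {p. \<forall>a\<in>Poly_Mapping.keys p. mdeg a \<le> d}"

lemma polys_upto_mono: "d \<le> e \<Longrightarrow> polys_upto d \<subseteq> polys_upto e"
  by (auto simp: polys_upto_def)

lemma polys_upto_mult: "p \<in> polys_upto d \<Longrightarrow> q \<in> polys_upto e \<Longrightarrow> p * q \<in> polys_upto (d + e)"
  using keys_mult[of p q] by (fastforce simp: polys_upto_def mdeg_add intro: add_mono)

lemma polys_upto_1 [simp]: "1 \<in> polys_upto 0"
  by (simp add: polys_upto_def)

lemma polys_upto_power: "p \<in> polys_upto d \<Longrightarrow> p ^ k \<in> polys_upto (d * k)"
  by (induction k) (auto dest: polys_upto_mult)

lemma polys_upto_prod:
  "finite A \<Longrightarrow> (\<And>i. i \<in> A \<Longrightarrow> p i \<in> polys_upto (d i)) \<Longrightarrow> (\<Prod>i\<in>A. p i) \<in> polys_upto (\<Sum>i\<in>A. d i)"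
  by (induction A rule: finite_induct) (auto intro!: polys_upto_mult)

lemma ex_polys_upto: "finite P \<Longrightarrow> \<exists>d. P \<subseteq> polys_upto d"
proof (induction P rule: finite_induct)
  case (insert p P)
  then obtain d where "P \<subseteq> polys_upto d" by auto
  \<comment> \<open>The sum of all monomial degrees is a crude bound that also covers
    \<open>p = 0\<close>, where there is no largest degree.\<close>
  moreover have "p \<in> polys_upto (\<Sum>a\<in>Poly_Mapping.keys p. mdeg a)"
    by (auto simp: polys_upto_def intro: member_le_sum)
  ultimately have "insert p P \<subseteq> polys_upto (max d (\<Sum>a\<in>Poly_Mapping.keys p. mdeg a))"
    using polys_upto_mono[of d "max d (\<Sum>a\<in>Poly_Mapping.keys p. mdeg a)"]
      polys_upto_mono[of "\<Sum>a\<in>Poly_Mapping.keys p. mdeg a" "max d (\<Sum>a\<in>Poly_Mapping.keys p. mdeg a)"] by auto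
  then show ?case by blast
qed simp

lemma mpoly_expand: "p = (\<Sum>a\<in>Poly_Mapping.keys p. Poly_Mapping.single a (Poly_Mapping.lookup p a))"
  by (rule poly_mapping_eqI) (auto simp: lookup_sum lookup_single when_def in_keys_iff)

lemma const_times_single: "const c * Poly_Mapping.single a d = Poly_Mapping.single a (c * d)"
  by (simp add: const_def mult_single)

lemma finite_bounded_lookup: "finite {a :: 'n::finite \<Rightarrow>\<^sub>0 nat. mdeg a \<le> J}"
proof (rule finite_imageD[of Poly_Mapping.lookup])
  have "Poly_Mapping.lookup ` {a :: 'n \<Rightarrow>\<^sub>0 nat. mdeg a \<le> J} \<subseteq> PiE UNIV (\<lambda>_. {..J})"
  proof (clarsimp simp: PiE_UNIV_domain)
    fix a :: "'n \<Rightarrow>\<^sub>0 nat" and i assume "mdeg a \<le> J"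
    moreover have "Poly_Mapping.lookup a i \<le> mdeg a"
      unfolding mdeg_def by (rule member_le_sum) auto
    ultimately show "Poly_Mapping.lookup a i \<le> J" by simp
  qed
  then show "finite (Poly_Mapping.lookup ` {a :: 'n \<Rightarrow>\<^sub>0 nat. mdeg a \<le> J})"
    by (rule finite_subset) (simp add: finite_PiE)
qed (auto intro!: inj_onI poly_mapping_eqI)

context poly_module
begin

lemma kspan_finsum:
  assumes "S \<subseteq> carrier M" "finite A" "\<And>a. a \<in> A \<Longrightarrow> f a \<in> kspan S"
  shows "finsum M f A \<in> kspan S"
  using assms(2,3)
proof (induction A rule: finite_induct)
  case (insert a A)
  have "f \<in> A \<rightarrow> carrier M" "f a \<in> carrier M"
    using insert.prems kspan_simps(4)[OF assms(1)] by auto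
  then show ?case using insert kspan_simps(2)[OF assms(1)] by (simp add: M.finsum_insert)
qed (use kspan_simps(1)[OF assms(1)] in simp)

lemma kspan_mono: "S \<subseteq> T \<Longrightarrow> kspan S \<subseteq> kspan T"
  by (rule KV.span_is_monotone)

text \<open>Scalar multiplication is additive in the polynomial and K-linear in the vector, so
  testing single terms of \<open>p\<close> on members of \<open>S\<close> is enough.\<close>

lemma smult_kspan:
  assumes S: "S \<subseteq> carrier M" and T: "T \<subseteq> carrier M"
    and *: "\<And>a c w. a \<in> Poly_Mapping.keys p \<Longrightarrow> w \<in> S \<Longrightarrow> Poly_Mapping.single a c \<odot>\<^bsub>M\<^esub> w \<in> kspan T"
    and v: "v \<in> kspan S"
  shows "p \<odot>\<^bsub>M\<^esub> v \<in> kspan T"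
proof -
  have single: "Poly_Mapping.single a c \<odot>\<^bsub>M\<^esub> w \<in> kspan T" if "a \<in> Poly_Mapping.keys p" "w \<in> kspan S" for a c w
  proof -
    have "kspan S \<subseteq> {w \<in> carrier M. Poly_Mapping.single a c \<odot>\<^bsub>M\<^esub> w \<in> kspan T}"
    proof (rule kspan_least)
      fix d w assume w: "w \<in> {w \<in> carrier M. Poly_Mapping.single a c \<odot>\<^bsub>M\<^esub> w \<in> kspan T}"
      then have "const d \<odot>\<^bsub>M\<^esub> (Poly_Mapping.single a c \<odot>\<^bsub>M\<^esub> w) \<in> kspan T"
        using kspan_simps(3)[OF T] by blast
      then show "const d \<odot>\<^bsub>M\<^esub> w \<in> {w \<in> carrier M. Poly_Mapping.single a c \<odot>\<^bsub>M\<^esub> w \<in> kspan T}"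
        using w smult_mult[of w "Poly_Mapping.single a c" "const d"] smult_mult[of w "const d" "Poly_Mapping.single a c"]
        by (simp add: mult.commute)
    next
      show "S \<subseteq> {w \<in> carrier M. Poly_Mapping.single a c \<odot>\<^bsub>M\<^esub> w \<in> kspan T}"
        using S *[OF that(1)] by auto
    qed (use kspan_simps(1,2)[OF T] in \<open>auto simp: smult_add_right\<close>)
    then show ?thesis using that(2) by auto
  qed
  have vM: "v \<in> carrier M" using kspan_simps(4)[OF S] v by auto
  have "p \<odot>\<^bsub>M\<^esub> v = (\<Sum>a\<in>Poly_Mapping.keys p. Poly_Mapping.single a (Poly_Mapping.lookup p a)) \<odot>\<^bsub>M\<^esub> v"
    using mpoly_expand[of p] by simp
  also have "\<dots> = (\<Oplus>\<^bsub>M\<^esub>a\<in>Poly_Mapping.keys p. Poly_Mapping.single a (Poly_Mapping.lookup p a) \<odot>\<^bsub>M\<^esub> v)"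
    by (rule smult_sum) (use vM in auto)
  also have "\<dots> \<in> kspan T"
    by (rule kspan_finsum[OF T]) (use single v in auto)
  finally show ?thesis .
qed

definition regular_chain ::
    "nat \<Rightarrow> (nat \<Rightarrow> 'm set) \<Rightarrow> (nat \<Rightarrow> ('k, 'n) mpoly) \<Rightarrow> 'm \<Rightarrow> bool"
  where "regular_chain r U f v \<longleftrightarrow>
    (\<forall>i\<le>r. submodule mpoly_ring (U i) M) \<and>
    (\<forall>i<r. U i \<subseteq> U (Suc i)) \<and>
    (\<forall>i<r. \<forall>w\<in>carrier M. (f i \<odot>\<^bsub>M\<^esub> w \<in> U i \<longrightarrow> w \<in> U i) \<and> f i \<odot>\<^bsub>M\<^esub> w \<in> U (Suc i)) \<and>
    v \<in> carrier M \<and> v \<notin> U r"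

lemma regular_chain_independent:
  assumes "regular_chain r U f v" "(\<Sum>a\<in>box r m. const (c a) * mpow f a) \<odot>\<^bsub>M\<^esub> v = \<zero>\<^bsub>M\<^esub>" "a \<in> box r m"
  shows "c a = 0"
proof -
  have "\<forall>a\<in>box r m. c a = 0"
  proof (rule mpow_independent[of r U f v])
    have "submodule mpoly_ring (U 0) M" using assms(1) by (simp add: regular_chain_def)
    then show "(\<Sum>a\<in>box r m. const (c a) * mpow f a) \<odot>\<^bsub>M\<^esub> v \<in> U 0"
      using assms(2) submodule.zero_closed by fastforce
  qed (use assms(1)[unfolded regular_chain_def] in blast)+
  then show ?thesis using assms(3) by blast
qed

lemma regular_chain_card_le:
  assumes chain: "regular_chain r U f v"
    and B: "finite B" "B \<subseteq> carrier M"
    and span: "\<And>a. a \<in> box r m \<Longrightarrow> mpow f a \<odot>\<^bsub>M\<^esub> v \<in> kspan B"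
  shows "Suc m ^ r \<le> card B"
proof -
  define g where "g a = mpow f a \<odot>\<^bsub>M\<^esub> v" for a
  have v: "v \<in> carrier M" using chain by (simp add: regular_chain_def)
  have gM: "g a \<in> carrier M" for a using v by (simp add: g_def)
  have inj: "inj_on g (box r m)"
  proof (rule inj_onI, rule ccontr)
    fix a b assume ab: "a \<in> box r m" "b \<in> box r m" "g a = g b" "a \<noteq> b"
    \<comment> \<open>Two exponents with equal image would give a relation with coefficients 1 and
      -1.\<close>
    define c :: "nat list \<Rightarrow> 'k" where "c x = (if x = a then 1 else if x = b then - 1 else 0)" for x
    have "(\<Sum>x\<in>box r m. const (c x) * mpow f x) = (\<Sum>x\<in>{a, b}. const (c x) * mpow f x)"
      using ab by (intro sum.mono_neutral_right finite_box) (auto simp: c_def)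
    also have "\<dots> = mpow f a + const (- 1) * mpow f b"
      using ab(4) by (simp add: c_def)
    finally have "(\<Sum>x\<in>box r m. const (c x) * mpow f x) \<odot>\<^bsub>M\<^esub> v = g a \<oplus>\<^bsub>M\<^esub> const (- 1) \<odot>\<^bsub>M\<^esub> g b"
      unfolding g_def using v by (simp only: smult_add_left smult_mult)
    also have "\<dots> = const 1 \<odot>\<^bsub>M\<^esub> g b \<oplus>\<^bsub>M\<^esub> const (- 1) \<odot>\<^bsub>M\<^esub> g b"
      using gM[of b] ab(3) by simp
    also have "\<dots> = (const 1 + const (- 1)) \<odot>\<^bsub>M\<^esub> g b"
      using gM by (simp only: smult_add_left)
    also have "const 1 + const (- 1) = const (0 :: 'k)"
      by (simp only: const_simps(3)[symmetric]) simp
    also have "const 0 \<odot>\<^bsub>M\<^esub> g b = \<zero>\<^bsub>M\<^esub>" using gM by simp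
    finally have "c a = 0" by (rule regular_chain_independent[OF chain _ ab(1)])
    then show False by (simp add: c_def)
  qed
  have "KV.lin_indpt (g ` box r m)"
  proof (rule KV.finite_lin_indpt2)
    fix b assume b: "KV.lincomb b (g ` box r m) = \<zero>\<^bsub>component_space M (carrier M)\<^esub>"
    have "(\<Sum>a\<in>box r m. const (b (g a)) * mpow f a) \<odot>\<^bsub>M\<^esub> v
        = (\<Oplus>\<^bsub>M\<^esub>a\<in>box r m. (const (b (g a)) * mpow f a) \<odot>\<^bsub>M\<^esub> v)"
      by (rule smult_sum[OF finite_box v])
    also have "\<dots> = (\<Oplus>\<^bsub>M\<^esub>a\<in>box r m. const (b (g a)) \<odot>\<^bsub>M\<^esub> g a)"
      by (simp only: g_def smult_mult[OF v])
    also have "\<dots> = (\<Oplus>\<^bsub>M\<^esub>w\<in>g ` box r m. const (b w) \<odot>\<^bsub>M\<^esub> w)"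
      by (rule M.add.finprod_reindex[symmetric]) (use inj gM in auto)
    also have "\<dots> = \<zero>\<^bsub>M\<^esub>" using b by (simp add: KV.lincomb_def)
    finally have "b (g a) = 0" if "a \<in> box r m" for a
      using regular_chain_independent[OF chain _ that, of "\<lambda>a. b (g a)"] by simp
    then show "\<forall>w\<in>g ` box r m. b w = \<zero>\<^bsub>ring_of_type_algebra\<^esub>" by auto
  qed (use finite_box gM in auto)
  moreover have "g ` box r m \<subseteq> kspan B" using span by (auto simp: g_def)
  \<comment> \<open>Steinitz exchange: the independent set is completed by a set \<open>C\<close>
    whose size is at most the difference of the two sizes, so that difference is
    nonnegative.\<close>
  ultimately obtain C :: "'m set" where "int (card C) \<le> int (card B) - int (card (g ` box r m))"
    using KV.replacement[of "g ` box r m" B] B finite_box by auto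
  then have "card (g ` box r m) \<le> card B" by linarith
  moreover have "card (g ` box r m) = Suc m ^ r"
    using card_lists_length_eq[of "{..m}" r] by (simp add: card_image[OF inj])
  ultimately show ?thesis by simp
qed

text \<open>Exponents up to \<open>m\<close> produce \<open>Suc m ^ r\<close> independent vectors
  inside a filtration step whose index is linear in \<open>m\<close>. The growth hypothesis allows
  only order \<open>m ^ d\<close> dimensions there.\<close>

lemma regular_chain_length_le:
  assumes chain: "regular_chain r U f v"
    and L: "\<And>p w d e. p \<in> polys_upto d \<Longrightarrow> w \<in> L e \<Longrightarrow> p \<odot>\<^bsub>M\<^esub> w \<in> L (d + e)"
    and L_mono: "\<And>i j. i \<le> j \<Longrightarrow> L i \<subseteq> L j"
    and v: "v \<in> L e"
    and B: "\<And>J. L J \<subseteq> kspan (B J)" "\<And>J. finite (B J)" "\<And>J. B J \<subseteq> carrier M"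
      "\<And>J. card (B J) \<le> C * Suc J ^ d"
  shows "r \<le> d"
proof (rule ccontr)
  assume "\<not> r \<le> d"
  obtain D where D: "f ` {..<r} \<subseteq> polys_upto D" using ex_polys_upto[of "f ` {..<r}"] by auto
  \<comment> \<open>\<open>C'\<close> is both the constant of the final estimate and the bound on
    the exponents. With this choice the estimate becomes
    \<open>Suc C' ^ r \<le> C' * Suc C' ^ d\<close>, which is impossible for
    \<open>r > d\<close>.\<close>
  define C' where "C' = C * (D * r + e + 1) ^ d"
  have "mpow f a \<odot>\<^bsub>M\<^esub> v \<in> L (D * (r * C') + e)" if "a \<in> box r C'" for a
  proof -
    have "mpow f a \<in> polys_upto (\<Sum>i<length a. D * a ! i)"
      unfolding mpow_def using D that by (intro polys_upto_prod polys_upto_power) auto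
    also have "(\<Sum>i<length a. D * a ! i) \<le> (\<Sum>i<length a. D * C')"
      using that by (intro sum_mono mult_left_mono) (auto dest: nth_mem)
    then have "(\<Sum>i<length a. D * a ! i) \<le> D * (r * C')" using that by (simp add: mult_ac)
    then have "polys_upto (\<Sum>i<length a. D * a ! i) \<subseteq> polys_upto (D * (r * C'))" by (rule polys_upto_mono)
    finally show ?thesis using L v by blast
  qed
  then have "Suc C' ^ r \<le> card (B (D * (r * C') + e))"
    using B by (intro regular_chain_card_le[OF chain]) blast+
  also have "\<dots> \<le> C * Suc (D * (r * C') + e) ^ d" by (rule B)
  also have "\<dots> \<le> C * ((D * r + e + 1) * Suc C') ^ d"
    by (intro mult_left_mono power_mono) (auto simp: algebra_simps)
  also have "\<dots> = C' * Suc C' ^ d"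
    by (simp only: C'_def power_mult_distrib mult.assoc)
  also have "\<dots> < Suc C' ^ Suc d" by simp
  also have "\<dots> \<le> Suc C' ^ r" using \<open>\<not> r \<le> d\<close> by (intro power_increasing) auto
  finally show False by simp
qed

end

section \<open>Graded modules\<close>

text \<open>Decompositions are summed over their own supports; to add or compare two of them, both
  are first summed over a common finite set.\<close>

lemma (in poly_module) finsum_support:
  assumes "finite T" "{j. f j \<noteq> \<zero>\<^bsub>M\<^esub>} \<subseteq> T" "\<And>j. f j \<in> carrier M"
  shows "(\<Oplus>\<^bsub>M\<^esub>j\<in>{j. f j \<noteq> \<zero>\<^bsub>M\<^esub>}. f j) = finsum M f T"
  using assms by (intro M.add.finprod_mono_neutral_cong_left) auto

locale graded_poly_module = poly_module M
  for M :: "(('k::field, 'n::finite) mpoly, 'm) module" (structure) and G :: "nat \<Rightarrow> 'm set" +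
  assumes graded: "graded_module M G"
begin

lemma component_subgroup: "subgroup (G j) (add_monoid M)"
  using graded by (simp add: graded_module_def)

lemma component_simps [simp]:
  "\<zero>\<^bsub>M\<^esub> \<in> G j" "v \<in> G j \<Longrightarrow> w \<in> G j \<Longrightarrow> v \<oplus>\<^bsub>M\<^esub> w \<in> G j" "v \<in> G j \<Longrightarrow> v \<in> carrier M"
  using subgroup.one_closed[OF component_subgroup] subgroup.m_closed[OF component_subgroup]
    subgroup.mem_carrier[OF component_subgroup] by auto

lemma component_subset: "G j \<subseteq> carrier M"
  by auto

lemma component_smult: "p \<in> homogeneous i \<Longrightarrow> v \<in> G j \<Longrightarrow> p \<odot>\<^bsub>M\<^esub> v \<in> G (i + j)"
  using graded by (simp add: graded_module_def)

lemma component_const [simp]: "v \<in> G j \<Longrightarrow> const c \<odot>\<^bsub>M\<^esub> v \<in> G j"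
  using component_smult[OF const_homogeneous, of v j c] by simp

lemma kspan_component: "kspan (G j) = G j"
  using kspan_simps(5)[OF component_subset] kspan_least[of "G j" "G j"] by fastforce

lemma component_submodule:
  "submodule (ring_of_type_algebra :: 'k ring) (G j) (component_space M (carrier M))"
  by (rule ksubspaceI) auto

lemma component_vectorspace:
  "vectorspace (ring_of_type_algebra :: 'k ring) (component_space M (G j))"
  using KV.subspace_is_vs[of "G j"] component_submodule KV.vectorspace_axioms by (simp add: subspace_def)

text \<open>Allows spans taken in different components to be compared inside the whole
  module.\<close>

lemma component_span:
  "S \<subseteq> G j \<Longrightarrow> LinearCombinations.module.span (ring_of_type_algebra :: 'k ring) (component_space M (G j)) S = kspan S"
  using KV.span_li_not_depend(1)[OF _ component_submodule, of S j] by simp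

abbreviation component_dim :: "nat \<Rightarrow> nat"
  where "component_dim j \<equiv> vectorspace.dim (ring_of_type_algebra :: 'k ring) (component_space M (G j))"

lemma decomposition:
  assumes "v \<in> carrier M"
  obtains f where "\<And>j. f j \<in> G j" "finite {j. f j \<noteq> \<zero>\<^bsub>M\<^esub>}" "v = (\<Oplus>\<^bsub>M\<^esub>j\<in>{j. f j \<noteq> \<zero>\<^bsub>M\<^esub>}. f j)"
proof -
  have "\<exists>f. (\<forall>j. f j \<in> G j) \<and> finite {j. f j \<noteq> \<zero>\<^bsub>M\<^esub>} \<and> v = (\<Oplus>\<^bsub>M\<^esub>j\<in>{j. f j \<noteq> \<zero>\<^bsub>M\<^esub>}. f j)"
    using graded assms unfolding graded_module_def by (blast dest: ex1_implies_ex)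
  then show ?thesis using that by blast
qed

text \<open>Uniqueness of the decomposition, applied to the one concentrated in degree
  \<open>j\<close>.\<close>

lemma component_eq:
  assumes v: "v \<in> G j"
    and f: "\<And>j. f j \<in> G j" "finite {j. f j \<noteq> \<zero>\<^bsub>M\<^esub>}" "v = (\<Oplus>\<^bsub>M\<^esub>j\<in>{j. f j \<noteq> \<zero>\<^bsub>M\<^esub>}. f j)"
  shows "f j = v"
proof -
  define h where "h k = (if k = j then v else \<zero>\<^bsub>M\<^esub>)" for k
  have "{k. h k \<noteq> \<zero>\<^bsub>M\<^esub>} = (if v = \<zero>\<^bsub>M\<^esub> then {} else {j})" by (auto simp: h_def)
  then have h: "finite {k. h k \<noteq> \<zero>\<^bsub>M\<^esub>}" "v = (\<Oplus>\<^bsub>M\<^esub>k\<in>{k. h k \<noteq> \<zero>\<^bsub>M\<^esub>}. h k)"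
    using v by (auto simp: h_def)
  have "h k \<in> G k" for k using v by (simp add: h_def)
  moreover have "\<exists>!f. (\<forall>j. f j \<in> G j) \<and> finite {j. f j \<noteq> \<zero>\<^bsub>M\<^esub>} \<and> v = (\<Oplus>\<^bsub>M\<^esub>j\<in>{j. f j \<noteq> \<zero>\<^bsub>M\<^esub>}. f j)"
    using graded v component_simps(3) unfolding graded_module_def by blast
  ultimately have "f = h" using f h by (blast dest: ex1_implies_ex)
  then show ?thesis by (simp add: h_def)
qed

definition upto :: "nat \<Rightarrow> 'm set"
  where "upto J = kspan (\<Union>j\<le>J. G j)"

lemma Union_subset: "(\<Union>j\<in>T. G j) \<subseteq> carrier M"
  by auto

lemma upto_mono: "i \<le> j \<Longrightarrow> upto i \<subseteq> upto j"
  unfolding upto_def by (intro kspan_mono UN_mono) auto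

lemma smult_upto:
  assumes "p \<in> polys_upto d" "w \<in> upto e"
  shows "p \<odot>\<^bsub>M\<^esub> w \<in> upto (d + e)"
  unfolding upto_def
proof (rule smult_kspan[OF Union_subset Union_subset])
  show "w \<in> kspan (\<Union>j\<le>e. G j)" using assms(2) by (simp add: upto_def)
  fix a c w assume "a \<in> Poly_Mapping.keys p" "w \<in> (\<Union>j\<le>e. G j)"
  moreover from this obtain j where "j \<le> e" "w \<in> G j" by auto
  ultimately have "Poly_Mapping.single a c \<odot>\<^bsub>M\<^esub> w \<in> G (mdeg a + j)" "mdeg a + j \<le> d + e"
    using component_smult[OF single_homogeneous] assms(1) by (auto simp: polys_upto_def intro: add_mono)
  then show "Poly_Mapping.single a c \<odot>\<^bsub>M\<^esub> w \<in> kspan (\<Union>j\<le>d + e. G j)"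
    using kspan_simps(5)[OF Union_subset, of "{..d + e}"] by auto
qed

lemma ex_upto:
  assumes "v \<in> carrier M"
  shows "\<exists>e. v \<in> upto e"
proof -
  obtain f where f: "\<And>j. f j \<in> G j" "finite {j. f j \<noteq> \<zero>\<^bsub>M\<^esub>}" "v = (\<Oplus>\<^bsub>M\<^esub>j\<in>{j. f j \<noteq> \<zero>\<^bsub>M\<^esub>}. f j)"
    using decomposition[OF assms] by blast
  obtain e where e: "{j. f j \<noteq> \<zero>\<^bsub>M\<^esub>} \<subseteq> {..e}"
    using f(2) finite_nat_set_iff_bounded_le by auto
  have "f j \<in> kspan (\<Union>j\<le>e. G j)" if "f j \<noteq> \<zero>\<^bsub>M\<^esub>" for j
    using that e f(1) kspan_simps(5)[OF Union_subset, of "{..e}"] by auto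
  then have "v \<in> upto e"
    unfolding upto_def by (subst f(3), intro kspan_finsum Union_subset f(2)) auto
  then show ?thesis ..
qed

text \<open>Monomial multiples of the homogeneous components of the generators span the module over
  K, and only finitely many of these products are formed in degree \<open>j\<close>. This yields the
  finite dimension of the components.\<close>

lemma finitely_generated_spanning:
  assumes fg: "finitely_generated M"
  shows "\<exists>W. finite W \<and> W \<subseteq> G j \<and> kspan W = G j"
proof -
  obtain A where A: "finite A" "A \<subseteq> carrier M" "span A = carrier M"
    using fg unfolding finitely_generated_def by blast
  have "\<forall>a\<in>A. \<exists>f. (\<forall>j. f j \<in> G j) \<and> finite {j. f j \<noteq> \<zero>\<^bsub>M\<^esub>} \<and> a = (\<Oplus>\<^bsub>M\<^esub>j\<in>{j. f j \<noteq> \<zero>\<^bsub>M\<^esub>}. f j)"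
  proof
    fix a assume "a \<in> A"
    then have "a \<in> carrier M" using A(2) by blast
    then show "\<exists>f. (\<forall>j. f j \<in> G j) \<and> finite {j. f j \<noteq> \<zero>\<^bsub>M\<^esub>} \<and> a = (\<Oplus>\<^bsub>M\<^esub>j\<in>{j. f j \<noteq> \<zero>\<^bsub>M\<^esub>}. f j)"
      by (rule decomposition) blast
  qed
  then obtain h where h: "\<And>a j. a \<in> A \<Longrightarrow> h a j \<in> G j" "\<And>a. a \<in> A \<Longrightarrow> finite {j. h a j \<noteq> \<zero>\<^bsub>M\<^esub>}"
      "\<And>a. a \<in> A \<Longrightarrow> a = (\<Oplus>\<^bsub>M\<^esub>j\<in>{j. h a j \<noteq> \<zero>\<^bsub>M\<^esub>}. h a j)"
    using bchoice[of A "\<lambda>a f. (\<forall>j. f j \<in> G j) \<and> finite {j. f j \<noteq> \<zero>\<^bsub>M\<^esub>} \<and> a = (\<Oplus>\<^bsub>M\<^esub>j\<in>{j. f j \<noteq> \<zero>\<^bsub>M\<^esub>}. f j)"]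
    by blast
  \<comment> \<open>\<open>e\<close> ranges over all degrees, so zero components
    \<open>h a e\<close> are included; the equation \<open>mdeg t + e = j\<close> still leaves
    finitely many triples.\<close>
  define W where "W j = {Poly_Mapping.single t 1 \<odot>\<^bsub>M\<^esub> h a e | t a e. a \<in> A \<and> mdeg t + e = j}" for j
  have W_sub: "W j \<subseteq> G j" for j
  proof
    fix w assume "w \<in> W j"
    then obtain t a e where w: "w = Poly_Mapping.single t 1 \<odot>\<^bsub>M\<^esub> h a e" "a \<in> A" "mdeg t + e = j"
      unfolding W_def by blast
    show "w \<in> G j" using component_smult[OF single_homogeneous h(1)[OF w(2)], of t 1 e] w(1,3) by metis
  qed
  have W_fin: "finite (W j)" for j
  proof (rule finite_subset)
    show "W j \<subseteq> (\<lambda>(t, a, e). Poly_Mapping.single t 1 \<odot>\<^bsub>M\<^esub> h a e) ` ({t. mdeg t \<le> j} \<times> A \<times> {..j})"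
      by (force simp: W_def)
  qed (use A(1) finite_bounded_lookup in auto)
  have WU: "(\<Union>j. W j) \<subseteq> carrier M" using W_sub component_subset by blast
  \<comment> \<open>The K-span of all the products is closed under polynomials. Since it contains
    the generators, it is the whole module.\<close>
  have "submodule mpoly_ring (kspan (\<Union>j. W j)) M"
  proof (rule submoduleI)
    fix c v assume v: "v \<in> kspan (\<Union>j. W j)"
    show "c \<odot>\<^bsub>M\<^esub> v \<in> kspan (\<Union>j. W j)"
    proof (rule smult_kspan[OF WU WU _ v])
      fix s d w assume "w \<in> (\<Union>j. W j)"
      then obtain t a e where w: "w = Poly_Mapping.single t 1 \<odot>\<^bsub>M\<^esub> h a e" "a \<in> A"
        by (auto simp: W_def)
      have *: "h a e \<in> carrier M" using h(1)[OF w(2), of e] by auto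
      have "Poly_Mapping.single s d * Poly_Mapping.single t 1 = const d * Poly_Mapping.single (s + t) (1 :: 'k)"
        by (simp add: const_def mult_single)
      then have "Poly_Mapping.single s d \<odot>\<^bsub>M\<^esub> w = const d \<odot>\<^bsub>M\<^esub> (Poly_Mapping.single (s + t) 1 \<odot>\<^bsub>M\<^esub> h a e)"
        by (simp only: w smult_mult[OF *, symmetric])
      moreover have "Poly_Mapping.single (s + t) 1 \<odot>\<^bsub>M\<^esub> h a e \<in> W (mdeg (s + t) + e)"
        unfolding W_def using w(2) by blast
      then have "Poly_Mapping.single (s + t) 1 \<odot>\<^bsub>M\<^esub> h a e \<in> kspan (\<Union>j. W j)"
        using kspan_simps(5)[OF WU] by blast
      then have "const d \<odot>\<^bsub>M\<^esub> (Poly_Mapping.single (s + t) 1 \<odot>\<^bsub>M\<^esub> h a e) \<in> kspan (\<Union>j. W j)"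
        by (rule kspan_simps(3)[OF WU])
      ultimately show "Poly_Mapping.single s d \<odot>\<^bsub>M\<^esub> w \<in> kspan (\<Union>j. W j)"
        by simp
    qed
  qed (use kspan_simps[OF WU] in auto)
  moreover have "A \<subseteq> kspan (\<Union>j. W j)"
  proof
    fix a assume a: "a \<in> A"
    have "h a e \<in> W e" for e
      using a h(1)[OF a, of e] by (auto simp: W_def intro!: exI[of _ 0] exI[of _ a] exI[of _ e])
    then have "h a e \<in> kspan (\<Union>j. W j)" for e using kspan_simps(5)[OF WU] by blast
    then show "a \<in> kspan (\<Union>j. W j)"
      by (subst h(3)[OF a]) (intro kspan_finsum WU h(2)[OF a])
  qed
  ultimately have gen: "carrier M \<subseteq> kspan (\<Union>j. W j)"
    using span_is_subset A(3) by blast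
  \<comment> \<open>To pass from the global span to single degrees, \<open>D\<close> collects the
    vectors with a decomposition whose part in each degree \<open>j\<close> lies in
    \<open>kspan (W j)\<close>. It is a K-subspace containing every \<open>W j\<close>, hence
    everything.\<close>
  define D where "D = {v \<in> carrier M. \<exists>f. (\<forall>j. f j \<in> kspan (W j)) \<and> finite {j. f j \<noteq> \<zero>\<^bsub>M\<^esub>} \<and>
    v = (\<Oplus>\<^bsub>M\<^esub>j\<in>{j. f j \<noteq> \<zero>\<^bsub>M\<^esub>}. f j)}"
  have DI: "v \<in> D" if "v \<in> carrier M" "\<And>j. h j \<in> kspan (W j)" "finite {j. h j \<noteq> \<zero>\<^bsub>M\<^esub>}"
      "v = (\<Oplus>\<^bsub>M\<^esub>j\<in>{j. h j \<noteq> \<zero>\<^bsub>M\<^esub>}. h j)" for v h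
    unfolding D_def using that by blast
  have Wc: "W j \<subseteq> carrier M" for j using W_sub component_subset by blast
  have Wk: "v \<in> carrier M" if "v \<in> kspan (W j)" for v j using kspan_simps(4)[OF Wc] that by blast
  have "kspan (\<Union>j. W j) \<subseteq> D"
  proof (rule kspan_least)
    show "\<zero>\<^bsub>M\<^esub> \<in> D"
      using kspan_simps(1)[OF Wc] by (auto simp: D_def intro!: exI[of _ "\<lambda>_. \<zero>\<^bsub>M\<^esub>"])
  next
    fix v w assume "v \<in> D" "w \<in> D"
    then obtain f g where f: "\<And>j. f j \<in> kspan (W j)" "finite {j. f j \<noteq> \<zero>\<^bsub>M\<^esub>}" "v = (\<Oplus>\<^bsub>M\<^esub>j\<in>{j. f j \<noteq> \<zero>\<^bsub>M\<^esub>}. f j)"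
      and g: "\<And>j. g j \<in> kspan (W j)" "finite {j. g j \<noteq> \<zero>\<^bsub>M\<^esub>}" "w = (\<Oplus>\<^bsub>M\<^esub>j\<in>{j. g j \<noteq> \<zero>\<^bsub>M\<^esub>}. g j)"
      and vw: "v \<in> carrier M" "w \<in> carrier M"
      by (auto simp: D_def)
    let ?T = "{j. f j \<noteq> \<zero>\<^bsub>M\<^esub>} \<union> {j. g j \<noteq> \<zero>\<^bsub>M\<^esub>}"
    let ?h = "\<lambda>j. f j \<oplus>\<^bsub>M\<^esub> g j"
    have fM: "f j \<in> carrier M" "g j \<in> carrier M" for j using Wk f(1) g(1) by blast+
    have T: "finite ?T" "{j. ?h j \<noteq> \<zero>\<^bsub>M\<^esub>} \<subseteq> ?T" using f(2) g(2) by auto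
    have "v = finsum M f ?T"
      unfolding f(3) by (rule finsum_support[OF T(1)]) (use fM in auto)
    moreover have "w = finsum M g ?T"
      unfolding g(3) by (rule finsum_support[OF T(1)]) (use fM in auto)
    ultimately have "v \<oplus>\<^bsub>M\<^esub> w = finsum M f ?T \<oplus>\<^bsub>M\<^esub> finsum M g ?T" by simp
    also have "\<dots> = finsum M ?h ?T"
      by (rule M.finsum_addf[symmetric]) (use fM in auto)
    also have "\<dots> = (\<Oplus>\<^bsub>M\<^esub>j\<in>{j. ?h j \<noteq> \<zero>\<^bsub>M\<^esub>}. ?h j)"
      by (rule finsum_support[OF T, symmetric]) (use fM in auto)
    finally have eq: "v \<oplus>\<^bsub>M\<^esub> w = (\<Oplus>\<^bsub>M\<^esub>j\<in>{j. ?h j \<noteq> \<zero>\<^bsub>M\<^esub>}. ?h j)" .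
    have "?h j \<in> kspan (W j)" for j by (rule kspan_simps(2)[OF Wc f(1) g(1)])
    then show "v \<oplus>\<^bsub>M\<^esub> w \<in> D"
      by (rule DI[OF _ _ finite_subset[OF T(2,1)] eq, rotated]) (use vw in simp)
  next
    fix c v assume "v \<in> D"
    then obtain f where f: "\<And>j. f j \<in> kspan (W j)" "finite {j. f j \<noteq> \<zero>\<^bsub>M\<^esub>}" "v = (\<Oplus>\<^bsub>M\<^esub>j\<in>{j. f j \<noteq> \<zero>\<^bsub>M\<^esub>}. f j)"
      and v: "v \<in> carrier M"
      by (auto simp: D_def)
    let ?T = "{j. f j \<noteq> \<zero>\<^bsub>M\<^esub>}" and ?h = "\<lambda>j. const c \<odot>\<^bsub>M\<^esub> f j"
    have fM: "f j \<in> carrier M" for j using Wk f(1) by blast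
    have T: "{j. ?h j \<noteq> \<zero>\<^bsub>M\<^esub>} \<subseteq> ?T" by auto
    have "const c \<odot>\<^bsub>M\<^esub> v = finsum M ?h ?T"
      using finsum_smult[of "const c" f ?T] f(3) fM by simp
    also have "\<dots> = (\<Oplus>\<^bsub>M\<^esub>j\<in>{j. ?h j \<noteq> \<zero>\<^bsub>M\<^esub>}. ?h j)"
      by (rule finsum_support[OF f(2) T, symmetric]) (use fM in auto)
    finally have eq: "const c \<odot>\<^bsub>M\<^esub> v = (\<Oplus>\<^bsub>M\<^esub>j\<in>{j. ?h j \<noteq> \<zero>\<^bsub>M\<^esub>}. ?h j)" .
    have "?h j \<in> kspan (W j)" for j by (rule kspan_simps(3)[OF Wc f(1)])
    then show "const c \<odot>\<^bsub>M\<^esub> v \<in> D"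
      by (rule DI[OF _ _ finite_subset[OF T f(2)] eq, rotated]) (use v in simp)
  next
    show "(\<Union>j. W j) \<subseteq> D"
    proof
      fix v assume "v \<in> (\<Union>j. W j)"
      then obtain j where j: "v \<in> W j" by auto
      let ?h = "\<lambda>k. if k = j then v else \<zero>\<^bsub>M\<^esub>"
      have v: "v \<in> carrier M" using j Wc by blast
      have T: "{k. ?h k \<noteq> \<zero>\<^bsub>M\<^esub>} \<subseteq> {j}" by auto
      have "v = finsum M ?h {j}" using v by simp
      also have "\<dots> = (\<Oplus>\<^bsub>M\<^esub>k\<in>{k. ?h k \<noteq> \<zero>\<^bsub>M\<^esub>}. ?h k)"
        by (rule finsum_support[OF _ T, symmetric]) (use v in auto)
      finally have eq: "v = (\<Oplus>\<^bsub>M\<^esub>k\<in>{k. ?h k \<noteq> \<zero>\<^bsub>M\<^esub>}. ?h k)" .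
      have mem: "?h k \<in> kspan (W k)" for k
        using kspan_simps(1,5)[OF Wc[of k]] j by auto
      have fin: "finite {k. ?h k \<noteq> \<zero>\<^bsub>M\<^esub>}" by (rule finite_subset[OF T]) simp
      show "v \<in> D" by (rule DI[OF v mem fin eq])
    qed
  qed (auto simp: D_def)
  have kW: "kspan (W j) \<subseteq> G j" for j
    using kspan_mono[OF W_sub] kspan_component by simp
  have "G j \<subseteq> kspan (W j)"
  proof
    fix v assume v: "v \<in> G j"
    then have "v \<in> D" using gen \<open>kspan (\<Union>j. W j) \<subseteq> D\<close> component_subset by blast
    then obtain f where f: "\<And>j. f j \<in> kspan (W j)" "finite {j. f j \<noteq> \<zero>\<^bsub>M\<^esub>}" "v = (\<Oplus>\<^bsub>M\<^esub>j\<in>{j. f j \<noteq> \<zero>\<^bsub>M\<^esub>}. f j)"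
      by (auto simp: D_def)
    \<comment> \<open>A decomposition from \<open>D\<close> is in particular a graded one, so for
      homogeneous \<open>v\<close> its part in degree \<open>j\<close> is \<open>v\<close>
      itself.\<close>
    have "f j = v" by (rule component_eq[OF v]) (use f kW in auto)
    then show "v \<in> kspan (W j)" using f(1)[of j] by simp
  qed
  then have "kspan (W j) = G j" by (rule antisym[OF kW])
  then show ?thesis using W_fin[of j] W_sub[of j] by (intro exI[of _ "W j"] conjI)
qed

lemma component_fin_dim:
  assumes "finitely_generated M"
  shows "vectorspace.fin_dim (ring_of_type_algebra :: 'k ring) (component_space M (G j))"
proof -
  interpret Gj: vectorspace "ring_of_type_algebra :: 'k ring" "component_space M (G j)"
    by (rule component_vectorspace)
  obtain W where W: "finite W" "W \<subseteq> G j" "kspan W = G j" using finitely_generated_spanning[OF assms] by blast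
  then show ?thesis unfolding Gj.fin_dim_def
    using component_span[OF W(2)] by (intro exI[of _ W]) simp
qed

lemma component_basis:
  assumes "finitely_generated M"
  shows "\<exists>W. finite W \<and> W \<subseteq> G j \<and> kspan W = G j \<and> card W = component_dim j"
proof -
  interpret Gj: vectorspace "ring_of_type_algebra :: 'k ring" "component_space M (G j)"
    by (rule component_vectorspace)
  obtain B where B: "finite B" "Gj.basis B"
    using Gj.finite_basis_exists component_fin_dim[OF assms] by blast
  then have "B \<subseteq> G j" "Gj.span B = G j" by (auto simp: Gj.basis_def)
  then show ?thesis using B Gj.dim_basis[OF B] component_span[of B j] by (intro exI[of _ B]) simp
qed

text \<open>The filtration is \<open>upto\<close>; bases of the components up to degree
  \<open>J\<close> together span its \<open>J\<close>-th step, so the summed Hilbert function bounds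
  the size of a spanning set.\<close>

lemma regular_chain_length_le_growth:
  assumes fg: "finitely_generated M" and chain: "regular_chain r U f v"
    and growth: "\<And>J. (\<Sum>j\<le>J. component_dim j) \<le> C * Suc J ^ d"
  shows "r \<le> d"
proof -
  obtain W where W: "\<And>j. finite (W j)" "\<And>j. W j \<subseteq> G j" "\<And>j. kspan (W j) = G j" "\<And>j. card (W j) = component_dim j"
    using component_basis[OF fg] by metis
  have v: "v \<in> carrier M" using chain by (simp add: regular_chain_def)
  obtain e where e: "v \<in> upto e" using ex_upto[OF v] by blast
  have sub: "(\<Union>j\<le>J. W j) \<subseteq> carrier M" for J
    using W(2) component_subset by blast
  show ?thesis
  proof (rule regular_chain_length_le[OF chain smult_upto upto_mono e])
    show "upto J \<subseteq> kspan (\<Union>j\<le>J. W j)" for J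
      unfolding upto_def
    proof (rule kspan_least)
      show "(\<Union>j\<le>J. G j) \<subseteq> kspan (\<Union>j\<le>J. W j)"
      proof (rule UN_least)
        fix j assume "j \<in> {..J}"
        then have "kspan (W j) \<subseteq> kspan (\<Union>j\<le>J. W j)" by (intro kspan_mono) blast
        then show "G j \<subseteq> kspan (\<Union>j\<le>J. W j)" by (simp only: W(3))
      qed
    qed (use kspan_simps[OF sub] in auto)
    show "card (\<Union>j\<le>J. W j) \<le> C * Suc J ^ d" for J
      using card_UN_le[of "{..J}" W] growth[of J] W(4) by simp
  qed (use W(1) sub in auto)
qed

end

section \<open>Quotients by monomial ideals\<close>

lemma mpoly_cring: "cring (mpoly_ring :: ('k::field, 'n::finite) mpoly ring)"
  by (rule cring_from_type_algebra)

text \<open>Negatives are obtained by multiplying with minus one, so no separate closure condition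
  for them appears.\<close>

lemma (in ring) ideal_closedI:
  assumes "Q \<subseteq> carrier R" "\<zero> \<in> Q" "\<And>p q. p \<in> Q \<Longrightarrow> q \<in> Q \<Longrightarrow> p \<oplus> q \<in> Q"
    "\<And>p r. p \<in> Q \<Longrightarrow> r \<in> carrier R \<Longrightarrow> r \<otimes> p \<in> Q" "\<And>p r. p \<in> Q \<Longrightarrow> r \<in> carrier R \<Longrightarrow> p \<otimes> r \<in> Q"
  shows "ideal Q R"
proof (rule idealI)
  show "subgroup Q (add_monoid R)"
  proof (rule group.subgroupI[OF a_group])
    fix p assume p: "p \<in> Q"
    then have "(\<ominus> \<one>) \<otimes> p \<in> Q" by (intro assms(4)) auto
    then show "inv\<^bsub>add_monoid R\<^esub> p \<in> Q"
      using p assms(1) by (auto simp: l_minus a_inv_def[symmetric])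
  qed (use assms in auto)
qed (use assms ring_axioms in auto)

lemma mpoly_ideal_iff:
  fixes I :: "('k::field, 'n::finite) mpoly set"
  shows "ideal I mpoly_ring \<longleftrightarrow> 0 \<in> I \<and> (\<forall>p\<in>I. \<forall>q\<in>I. p + q \<in> I) \<and> (\<forall>p\<in>I. \<forall>q. q * p \<in> I)"
proof
  assume I: "ideal I mpoly_ring"
  interpret ideal I "mpoly_ring :: ('k, 'n) mpoly ring" by fact
  show "0 \<in> I \<and> (\<forall>p\<in>I. \<forall>q\<in>I. p + q \<in> I) \<and> (\<forall>p\<in>I. \<forall>q. q * p \<in> I)"
    using additive_subgroup.zero_closed[OF additive_subgroup_axioms] additive_subgroup.a_closed[OF additive_subgroup_axioms]
      I_l_closed by auto
next
  assume *: "0 \<in> I \<and> (\<forall>p\<in>I. \<forall>q\<in>I. p + q \<in> I) \<and> (\<forall>p\<in>I. \<forall>q. q * p \<in> I)"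
  interpret S: cring "mpoly_ring :: ('k, 'n) mpoly ring" by (rule mpoly_cring)
  show "ideal I mpoly_ring"
    by (rule S.ideal_closedI) (use * in \<open>auto simp: mult.commute\<close>)
qed

locale mpoly_ideal =
  fixes I :: "('k::field, 'n::finite) mpoly set"
  assumes ideal: "ideal I mpoly_ring"
begin

lemma ideal_simps [simp]:
  "0 \<in> I" "p \<in> I \<Longrightarrow> q \<in> I \<Longrightarrow> p + q \<in> I" "p \<in> I \<Longrightarrow> q * p \<in> I" "p \<in> I \<Longrightarrow> p * q \<in> I"
  using ideal unfolding mpoly_ideal_iff by (auto simp: mult.commute)

lemma ideal_uminus [simp]: "- p \<in> I \<longleftrightarrow> p \<in> I"
  using ideal_simps(3)[of p "- 1"] ideal_simps(3)[of "- p" "- 1"] by auto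

lemma ideal_sum: "(\<And>a. a \<in> A \<Longrightarrow> f a \<in> I) \<Longrightarrow> sum f A \<in> I"
  by (induction A rule: infinite_finite_induct) auto

abbreviation cl :: "('k, 'n) mpoly \<Rightarrow> ('k, 'n) mpoly set"
  where "cl p \<equiv> I +>\<^bsub>mpoly_ring\<^esub> p"

lemma mem_cl_iff: "q \<in> cl p \<longleftrightarrow> q - p \<in> I"
proof
  assume "q - p \<in> I"
  moreover have "q = (q - p) + p" by simp
  ultimately show "q \<in> cl p" unfolding a_r_coset_def' by force
qed (auto simp: a_r_coset_def')

lemma cl_eq_iff: "cl p = cl q \<longleftrightarrow> p - q \<in> I"
proof
  assume "cl p = cl q"
  moreover have "p \<in> cl p" by (simp add: mem_cl_iff)
  ultimately show "p - q \<in> I" using mem_cl_iff by blast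
next
  assume pq: "p - q \<in> I"
  have "x \<in> cl p \<longleftrightarrow> x \<in> cl q" for x
    using ideal_simps(2)[OF _ pq, of "x - p"] ideal_simps(2)[of "x - q" "- (p - q)"] pq
    by (auto simp: mem_cl_iff simp del: minus_diff_eq)
  then show "cl p = cl q" by blast
qed

lemma cl_0: "cl 0 = I"
  by (auto simp: mem_cl_iff)

abbreviation M :: "(('k, 'n) mpoly, ('k, 'n) mpoly set) module"
  where "M \<equiv> quot_module I"

lemma cl_ring_hom: "cl \<in> ring_hom mpoly_ring (mpoly_ring Quot I)"
  by (rule ideal.rcos_ring_hom[OF ideal])

lemma quot_simps [simp]:
  "carrier (mpoly_ring Quot I) = range cl"
  "\<zero>\<^bsub>mpoly_ring Quot I\<^esub> = cl 0" "\<one>\<^bsub>mpoly_ring Quot I\<^esub> = cl 1"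
  "cl p \<oplus>\<^bsub>mpoly_ring Quot I\<^esub> cl q = cl (p + q)" "cl p \<otimes>\<^bsub>mpoly_ring Quot I\<^esub> cl q = cl (p * q)"
  using ring_hom_add[OF cl_ring_hom, of p q] ring_hom_mult[OF cl_ring_hom, of p q]
  by (auto simp: cl_0) (auto simp: FactRing_def A_RCOSETS_def')

lemma quot_module_simps [simp]:
  "carrier M = range cl" "\<zero>\<^bsub>M\<^esub> = cl 0" "cl p \<oplus>\<^bsub>M\<^esub> cl q = cl (p + q)" "p \<odot>\<^bsub>M\<^esub> cl q = cl (p * q)"
  using quot_simps by (auto simp: quot_module_def Let_def)

lemma poly_module_quot: "poly_module M"
  unfolding poly_module_def
proof (rule module_criteria)
  show "\<forall>v\<in>carrier M. \<exists>w\<in>carrier M. v \<oplus>\<^bsub>M\<^esub> w = \<zero>\<^bsub>M\<^esub>"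
  proof
    fix v assume "v \<in> carrier M"
    then obtain p where "v = cl p" by auto
    then show "\<exists>w\<in>carrier M. v \<oplus>\<^bsub>M\<^esub> w = \<zero>\<^bsub>M\<^esub>" by (intro bexI[of _ "cl (- p)"]) auto
  qed
qed (auto simp: mpoly_cring algebra_simps)

sublocale poly_module M
  by (rule poly_module_quot)

lemma finsum_cl: "finite A \<Longrightarrow> (\<Oplus>\<^bsub>M\<^esub>a\<in>A. cl (f a)) = cl (\<Sum>a\<in>A. f a)"
  by (induction A rule: finite_induct) auto

lemma quot_a_inv: "\<ominus>\<^bsub>M\<^esub> cl p = cl (- p)"
  by (rule M.minus_equality) auto

lemma finitely_generated_quot: "finitely_generated M"
  unfolding finitely_generated_def
proof (intro exI[of _ "{cl 1}"] conjI)
  interpret submodule mpoly_ring "span {cl 1}" M by (rule span_is_submodule) simp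
  have "cl 1 \<in> span {cl 1}" using in_own_span[of "{cl 1}"] by simp
  then have "cl p \<in> span {cl 1}" for p using smult_closed[of p "cl 1"] by simp
  then show "span {cl 1} = carrier M" using subset by auto
qed auto

end

section \<open>Squarefree monomial ideals, described through supports of monomials\<close>

definition monomial_ideal :: "'n set set \<Rightarrow> ('k::field, 'n::finite) mpoly set"
  where "monomial_ideal F = {p. \<forall>a\<in>Poly_Mapping.keys p. \<exists>B\<in>F. B \<subseteq> Poly_Mapping.keys a}"

lemma ideal_monomial_ideal: "ideal (monomial_ideal F) (mpoly_ring :: ('k::field, 'n::finite) mpoly ring)"
  unfolding mpoly_ideal_iff
proof (intro conjI ballI allI)
  fix p q :: "('k, 'n) mpoly"
  assume p: "p \<in> monomial_ideal F"
  show "q * p \<in> monomial_ideal F"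
    unfolding monomial_ideal_def
  proof (clarify)
    fix x assume "x \<in> Poly_Mapping.keys (q * p)"
    then obtain a b where ab: "x = a + b" "b \<in> Poly_Mapping.keys p" using keys_mult[of q p] by auto
    then obtain B where "B \<in> F" "B \<subseteq> Poly_Mapping.keys b" using p by (auto simp: monomial_ideal_def)
    moreover have "Poly_Mapping.keys b \<subseteq> Poly_Mapping.keys x"
      by (auto simp: ab(1) in_keys_iff lookup_add)
    ultimately show "\<exists>B\<in>F. B \<subseteq> Poly_Mapping.keys x" by blast
  qed
  assume "q \<in> monomial_ideal F"
  then show "p + q \<in> monomial_ideal F"
    using p keys_add[of p q] by (auto simp: monomial_ideal_def)
qed (simp add: monomial_ideal_def)

lemma prod_var: "(\<Prod>i\<in>A. var i) = Poly_Mapping.single (\<Sum>i\<in>A. Poly_Mapping.single i 1) (1 :: 'k::field)"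
  for A :: "'n::finite set"
  by (induction A rule: infinite_finite_induct) (auto simp: var_def mult_single)

lemma lookup_sum_single: "Poly_Mapping.lookup (\<Sum>i\<in>A. Poly_Mapping.single i (1 :: nat)) j = (if j \<in> A then 1 else 0)"
  for A :: "'n::finite set"
  by (simp add: lookup_sum lookup_single when_def)

lemma prod_var_in_monomial_ideal_iff:
  "(\<Prod>i\<in>A. var i) \<in> (monomial_ideal F :: ('k::field, 'n::finite) mpoly set) \<longleftrightarrow> (\<exists>B\<in>F. B \<subseteq> A)"
proof -
  have "Poly_Mapping.keys (\<Sum>i\<in>A. Poly_Mapping.single i (1 :: nat)) = A"
    using lookup_sum_single[of A] by (auto simp: in_keys_iff split: if_splits)
  then show ?thesis unfolding prod_var monomial_ideal_def by simp
qed

text \<open>A monomial whose support contains \<open>B\<close> is a multiple of the squarefree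
  monomial of \<open>B\<close>, and a polynomial is the sum of its terms. From here on, membership
  in \<open>I\<close> is a condition on the support of each monomial.\<close>

lemma Idl_monomials:
  "Idl\<^bsub>mpoly_ring\<^esub> ((\<lambda>A. \<Prod>i\<in>A. var i) ` F) = (monomial_ideal F :: ('k::field, 'n::finite) mpoly set)"
proof
  interpret S: cring "mpoly_ring :: ('k, 'n) mpoly ring" by (rule mpoly_cring)
  let ?J = "Idl\<^bsub>mpoly_ring\<^esub> ((\<lambda>A. \<Prod>i\<in>A. var i) ` F) :: ('k, 'n) mpoly set"
  show "?J \<subseteq> monomial_ideal F"
    by (rule S.genideal_minimal[OF ideal_monomial_ideal]) (auto simp: prod_var_in_monomial_ideal_iff)
  interpret J: mpoly_ideal ?J by (rule mpoly_ideal.intro, rule S.genideal_ideal) simp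
  show "monomial_ideal F \<subseteq> ?J"
  proof
    fix p :: "('k, 'n) mpoly" assume p: "p \<in> monomial_ideal F"
    have "Poly_Mapping.single a (Poly_Mapping.lookup p a) \<in> ?J" if "a \<in> Poly_Mapping.keys p" for a
    proof -
      obtain B where B: "B \<in> F" "B \<subseteq> Poly_Mapping.keys a" using p \<open>a \<in> _\<close> by (auto simp: monomial_ideal_def)
      let ?e = "\<Sum>i\<in>B. Poly_Mapping.single i (1 :: nat)"
      \<comment> \<open>Subtraction of exponents truncates at 0, but it is exact here because
        \<open>a\<close> is positive on \<open>B\<close>.\<close>
      have "a = (a - ?e) + ?e"
        using B(2) lookup_sum_single[of B]
        by (intro poly_mapping_eqI) (auto simp: lookup_add lookup_minus in_keys_iff subset_iff)
      then have "Poly_Mapping.single a (Poly_Mapping.lookup p a) = Poly_Mapping.single (a - ?e) (Poly_Mapping.lookup p a) * (\<Prod>i\<in>B. var i)"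
        unfolding prod_var by (simp add: mult_single)
      moreover have "(\<Prod>i\<in>B. var i) \<in> ?J"
        using S.genideal_self[of "(\<lambda>A. \<Prod>i\<in>A. var i) ` F"] B(1) by auto
      ultimately show ?thesis by simp
    qed
    then show "p \<in> ?J" by (subst mpoly_expand) (rule J.ideal_sum)
  qed
qed

section \<open>Homogeneous parts and the grading of the quotient\<close>

definition part :: "nat \<Rightarrow> ('k::field, 'n::finite) mpoly \<Rightarrow> ('k, 'n) mpoly"
  where "part j p = (\<Sum>a\<in>{a\<in>Poly_Mapping.keys p. mdeg a = j}. Poly_Mapping.single a (Poly_Mapping.lookup p a))"

lemma lookup_part: "Poly_Mapping.lookup (part j p) a = (if mdeg a = j then Poly_Mapping.lookup p a else 0)"
  by (auto simp: part_def lookup_sum lookup_single when_def in_keys_iff)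

lemma part_homogeneous: "part j p \<in> homogeneous j"
  by (auto simp: homogeneous_iff in_keys_iff lookup_part split: if_splits)

lemma sum_part: "finite T \<Longrightarrow> mdeg ` Poly_Mapping.keys p \<subseteq> T \<Longrightarrow> (\<Sum>j\<in>T. part j p) = p"
  by (rule poly_mapping_eqI) (auto simp: lookup_sum lookup_part in_keys_iff image_subset_iff)

lemma homogeneous_closed:
  "0 \<in> homogeneous j" "p \<in> homogeneous j \<Longrightarrow> q \<in> homogeneous j \<Longrightarrow> p + q \<in> homogeneous j"
  "p \<in> homogeneous j \<Longrightarrow> - p \<in> homogeneous j"
  "p \<in> homogeneous j \<Longrightarrow> q \<in> homogeneous j \<Longrightarrow> p - q \<in> homogeneous j"
  using keys_add[of p q] keys_diff[of p q] by (auto simp: homogeneous_iff in_keys_iff)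

lemma homogeneous_mult:
  "p \<in> homogeneous i \<Longrightarrow> q \<in> homogeneous j \<Longrightarrow> p * q \<in> homogeneous (i + j)"
  using keys_mult[of p q] by (fastforce simp: homogeneous_iff mdeg_add)

locale monomial_quotient =
  fixes F :: "'n::finite set set" and I :: "('k::field, 'n) mpoly set"
  assumes I: "I = monomial_ideal F"
begin

sublocale mpoly_ideal I
  by (rule mpoly_ideal.intro) (simp add: I ideal_monomial_ideal)

abbreviation G :: "nat \<Rightarrow> ('k, 'n) mpoly set set"
  where "G \<equiv> quot_grading I"

text \<open>Existence comes from the homogeneous parts of a representative. Uniqueness holds because
  membership in a monomial ideal is tested on each monomial, so the homogeneous parts of a member
  are members.\<close>

lemma graded_quot: "graded_module M G"
  unfolding graded_module_def
proof (intro conjI allI ballI)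
  show "Module.module mpoly_ring M" by (rule module_axioms)
next
  fix j
  show "subgroup (G j) (add_monoid M)"
  proof (rule group.subgroupI[OF M.a_group])
    show "G j \<noteq> {}" using homogeneous_closed(1) by (auto simp: quot_grading_def)
    fix v assume v: "v \<in> G j"
    then show "inv\<^bsub>add_monoid M\<^esub> v \<in> G j"
      using quot_a_inv homogeneous_closed(3) by (force simp: quot_grading_def a_inv_def)
    fix w assume "w \<in> G j"
    then show "v \<otimes>\<^bsub>add_monoid M\<^esub> w \<in> G j"
      using v homogeneous_closed(2) by (force simp: quot_grading_def)
  qed (auto simp: quot_grading_def)
next
  fix v assume "v \<in> carrier M"
  then obtain p where v: "v = cl p" by auto
  let ?supp = "\<lambda>f. {j. f j \<noteq> \<zero>\<^bsub>M\<^esub>}"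
  let ?f = "\<lambda>j. cl (part j p)"
  have T: "finite (mdeg ` Poly_Mapping.keys p)" by simp
  have part0: "part j p = 0" if "j \<notin> mdeg ` Poly_Mapping.keys p" for j
    using that by (intro poly_mapping_eqI) (auto simp: lookup_part in_keys_iff)
  then have sub: "?supp ?f \<subseteq> mdeg ` Poly_Mapping.keys p" by fastforce
  show "\<exists>!f. (\<forall>j. f j \<in> G j) \<and> finite (?supp f) \<and> v = finsum M f (?supp f)"
  proof (rule ex1I[of _ ?f])
    have "finsum M ?f (?supp ?f) = finsum M ?f (mdeg ` Poly_Mapping.keys p)"
      by (rule finsum_support[OF T sub]) simp
    also have "\<dots> = v" using finsum_cl[OF T] sum_part[OF T order_refl] v by simp
    finally show "(\<forall>j. ?f j \<in> G j) \<and> finite (?supp ?f) \<and> v = finsum M ?f (?supp ?f)"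
      using finite_subset[OF sub T] part_homogeneous by (auto simp: quot_grading_def)
  next
    fix g assume g: "(\<forall>j. g j \<in> G j) \<and> finite (?supp g) \<and> v = finsum M g (?supp g)"
    then have "\<forall>j. \<exists>q. q \<in> homogeneous j \<and> g j = cl q" by (auto simp: quot_grading_def)
    then obtain q where q: "\<And>j. q j \<in> homogeneous j" "\<And>j. g j = cl (q j)" by metis
    \<comment> \<open>Outside \<open>?T\<close> both families vanish, so both can be summed over
      it.\<close>
    let ?T = "mdeg ` Poly_Mapping.keys p \<union> ?supp g"
    have T': "finite ?T" using g by simp
    have "finsum M g (?supp g) = finsum M g ?T"
      by (rule finsum_support[OF T']) (use q(2) in auto)
    then have "v = finsum M g ?T" using g by simp
    also have "\<dots> = (\<Oplus>\<^bsub>M\<^esub>j\<in>?T. cl (q j))" by (rule M.finsum_cong') (use q(2) in auto)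
    also have "\<dots> = cl (\<Sum>j\<in>?T. q j)" by (rule finsum_cl[OF T'])
    finally have "cl (\<Sum>j\<in>?T. part j p) = cl (\<Sum>j\<in>?T. q j)"
      using v sum_part[OF T', of p] by simp
    then have diff: "(\<Sum>j\<in>?T. part j p - q j) \<in> I"
      by (simp add: cl_eq_iff sum_subtractf)
    show "g = ?f"
    proof
      fix k
      show "g k = ?f k"
      proof (cases "k \<in> ?T")
        case True
        \<comment> \<open>The summands are homogeneous of distinct degrees, so a monomial of degree
          \<open>k\<close> cannot cancel in the sum \<open>diff\<close>; it therefore satisfies the
          support condition of \<open>I\<close>.\<close>
        have "part k p - q k \<in> I"
          unfolding I monomial_ideal_def
        proof clarify
          fix a assume a: "a \<in> Poly_Mapping.keys (part k p - q k)"
          have hom: "part j p - q j \<in> homogeneous j" for j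
            using homogeneous_closed(4)[OF part_homogeneous q(1)] .
          have "mdeg a = k" using a hom[of k] by (simp add: homogeneous_iff)
          then have "Poly_Mapping.lookup (part j p - q j) a = 0" if "j \<noteq> k" for j
            using hom[of j] that by (auto simp: homogeneous_iff in_keys_iff)
          then have "Poly_Mapping.lookup (\<Sum>j\<in>?T. part j p - q j) a = (\<Sum>j\<in>{k}. Poly_Mapping.lookup (part j p - q j) a)"
            unfolding lookup_sum using T' True by (intro sum.mono_neutral_right) auto
          then have "a \<in> Poly_Mapping.keys (\<Sum>j\<in>?T. part j p - q j)"
            using a by (simp add: in_keys_iff)
          then show "\<exists>B\<in>F. B \<subseteq> Poly_Mapping.keys a"
            using diff unfolding I monomial_ideal_def by blast
        qed
        then show ?thesis using q(2) cl_eq_iff by metis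
      next
        case False
        then show ?thesis using part0[of k] by simp
      qed
    qed
  qed
next
  fix i j v and p :: "('k, 'n) mpoly" assume "p \<in> homogeneous i" "v \<in> G j"
  then show "p \<odot>\<^bsub>M\<^esub> v \<in> G (i + j)" using homogeneous_mult by (force simp: quot_grading_def)
qed

sublocale graded_poly_module M G
  by unfold_locales (rule graded_quot)

end

section \<open>Krull dimension of monomial quotients\<close>

text \<open>Such an exponent vector is determined by its values on \<open>A\<close>, each of which
  is at most \<open>J\<close>.\<close>

lemma card_bounded_support:
  "card {a :: 'n::finite \<Rightarrow>\<^sub>0 nat. mdeg a \<le> J \<and> Poly_Mapping.keys a \<subseteq> A} \<le> Suc J ^ card A"
proof -
  let ?S = "{a :: 'n \<Rightarrow>\<^sub>0 nat. mdeg a \<le> J \<and> Poly_Mapping.keys a \<subseteq> A}"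
  let ?f = "\<lambda>a :: 'n \<Rightarrow>\<^sub>0 nat. restrict (Poly_Mapping.lookup a) A"
  have "card ?S \<le> card (PiE A (\<lambda>_. {..J}))"
  proof (rule card_inj_on_le[of ?f])
    show "inj_on ?f ?S"
    proof (intro inj_onI poly_mapping_eqI)
      fix a b i assume ab: "a \<in> ?S" "b \<in> ?S" "?f a = ?f b"
      show "Poly_Mapping.lookup a i = Poly_Mapping.lookup b i"
      proof (cases "i \<in> A")
        case True
        then show ?thesis using fun_cong[OF ab(3), of i] by simp
      next
        case False
        then have "i \<notin> Poly_Mapping.keys a" "i \<notin> Poly_Mapping.keys b" using ab by auto
        then show ?thesis by (simp add: in_keys_iff)
      qed
    qed
    show "?f ` ?S \<subseteq> PiE A (\<lambda>_. {..J})"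
    proof clarify
      fix a :: "'n \<Rightarrow>\<^sub>0 nat" assume "mdeg a \<le> J"
      moreover have "Poly_Mapping.lookup a i \<le> mdeg a" for i
        unfolding mdeg_def by (rule member_le_sum) auto
      ultimately show "?f a \<in> PiE A (\<lambda>_. {..J})" by (auto intro: order_trans)
    qed
  qed (simp add: finite_PiE)
  then show ?thesis by (simp add: card_PiE)
qed

section \<open>The primes generated by the variables outside a set\<close>

definition linear_prime :: "'n set \<Rightarrow> ('k::field, 'n::finite) mpoly set"
  where "linear_prime A = monomial_ideal ((\<lambda>i. {i}) ` (- A))"

lemma linear_prime_iff: "p \<in> linear_prime A \<longleftrightarrow> (\<forall>a\<in>Poly_Mapping.keys p. \<not> Poly_Mapping.keys a \<subseteq> A)"
  by (auto simp: linear_prime_def monomial_ideal_def)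

lemma ex_leading_exponent:
  assumes "finite S" "S \<noteq> {}"
  fixes \<phi> :: "'a \<Rightarrow> 'b::linorder"
  shows "\<exists>a\<in>S. \<forall>b\<in>S. \<phi> b \<le> \<phi> a"
proof -
  have "Max (\<phi> ` S) \<in> \<phi> ` S" using assms by (intro Max_in) auto
  then obtain a where a: "a \<in> S" "\<phi> a = Max (\<phi> ` S)" by auto
  have "\<phi> b \<le> \<phi> a" if "b \<in> S" for b unfolding a(2) using assms(1) that by (intro Max_ge) auto
  then show ?thesis using a(1) by blast
qed

lemma keys_add_nat: "Poly_Mapping.keys (a + b) = Poly_Mapping.keys a \<union> Poly_Mapping.keys (b :: 'a \<Rightarrow>\<^sub>0 nat)"
  by (auto simp: in_keys_iff lookup_add)

text \<open>
  Leading exponents need a monomial order, but \<open>'n\<close> carries no order.  The additive injection \<open>\<phi>\<close> below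
  borrows the lexicographic order of \<open>nat \<Rightarrow>\<^sub>0 nat\<close>.
\<close>

lemma linear_prime_mult:
  fixes p q :: "('k::field, 'n::finite) mpoly"
  assumes p: "p \<notin> linear_prime A" and q: "q \<notin> linear_prime A"
  shows "p * q \<notin> linear_prime A"
proof -
  obtain e :: "'n \<Rightarrow> nat" where e: "inj e"
    using finite_imp_inj_to_nat_seg[of "UNIV :: 'n set"] by auto
  define \<phi> :: "('n \<Rightarrow>\<^sub>0 nat) \<Rightarrow> (nat \<Rightarrow>\<^sub>0 nat)" where "\<phi> a = (\<Sum>i\<in>UNIV. Poly_Mapping.single (e i) (Poly_Mapping.lookup a i))" for a
  have \<phi>_add: "\<phi> (a + b) = \<phi> a + \<phi> b" for a b
    by (simp add: \<phi>_def lookup_add single_add sum.distrib)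
  have \<phi>_lookup: "Poly_Mapping.lookup (\<phi> a) (e i) = Poly_Mapping.lookup a i" for a i
    using e by (simp add: \<phi>_def lookup_sum lookup_single when_def inj_eq)
  then have \<phi>_inj: "a = b" if "\<phi> a = \<phi> b" for a b using that by (metis poly_mapping_eqI)
  \<comment> \<open>Only monomials supported in \<open>A\<close> matter modulo
    \<open>linear_prime A\<close>; \<open>a0\<close> and \<open>b0\<close> below are the leading
    ones among them.\<close>
  define good where "good r = {a \<in> Poly_Mapping.keys r. Poly_Mapping.keys a \<subseteq> A}" for r :: "('k, 'n) mpoly"
  have "good p \<noteq> {}" "good q \<noteq> {}" using p q by (auto simp: good_def linear_prime_iff)
  moreover have "finite (good p)" "finite (good q)" by (simp_all add: good_def)
  ultimately obtain a0 b0 where a0: "a0 \<in> good p" "\<And>a. a \<in> good p \<Longrightarrow> \<phi> a \<le> \<phi> a0"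
    and b0: "b0 \<in> good q" "\<And>b. b \<in> good q \<Longrightarrow> \<phi> b \<le> \<phi> b0"
    using ex_leading_exponent[of "good p" \<phi>] ex_leading_exponent[of "good q" \<phi>] by blast
  \<comment> \<open>The support of a sum of exponents is the union of the supports, so every pair of
    monomials contributing to \<open>a0 + b0\<close> is supported in \<open>A\<close>. Maximality of
    \<open>a0\<close> and \<open>b0\<close> then leaves one pair, and nothing can cancel its
    product.\<close>
  have unique: "a = a0 \<and> b = b0"
    if "a \<in> Poly_Mapping.keys p" "b \<in> Poly_Mapping.keys q" "a + b = a0 + b0" for a b
  proof -
    have "Poly_Mapping.keys a \<union> Poly_Mapping.keys b \<subseteq> A"
      using arg_cong[OF that(3), of Poly_Mapping.keys] a0(1) b0(1) by (auto simp: keys_add_nat good_def)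
    then have le: "\<phi> a \<le> \<phi> a0" "\<phi> b \<le> \<phi> b0" using that a0(2) b0(2) by (auto simp: good_def)
    have sum: "\<phi> a + \<phi> b = \<phi> a0 + \<phi> b0" using that(3) \<phi>_add by metis
    have "\<phi> a = \<phi> a0"
      using le sum add_less_le_mono[of "\<phi> a" "\<phi> a0" "\<phi> b" "\<phi> b0"] by (metis order_le_imp_less_or_eq less_irrefl)
    then show ?thesis using sum \<phi>_inj by simp
  qed
  have "p * q = (\<Sum>a\<in>Poly_Mapping.keys p. \<Sum>b\<in>Poly_Mapping.keys q.
      Poly_Mapping.single (a + b) (Poly_Mapping.lookup p a * Poly_Mapping.lookup q b))"
  proof -
    have "p * q = (\<Sum>a\<in>Poly_Mapping.keys p. Poly_Mapping.single a (Poly_Mapping.lookup p a)) *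
        (\<Sum>b\<in>Poly_Mapping.keys q. Poly_Mapping.single b (Poly_Mapping.lookup q b))"
      by (simp only: mpoly_expand[symmetric])
    then show ?thesis by (simp only: sum_product mult_single)
  qed
  then have "Poly_Mapping.lookup (p * q) (a0 + b0) = (\<Sum>a\<in>Poly_Mapping.keys p. \<Sum>b\<in>Poly_Mapping.keys q.
      (Poly_Mapping.lookup p a * Poly_Mapping.lookup q b when a + b = a0 + b0))"
    by (simp add: lookup_sum lookup_single)
  also have "\<dots> = (\<Sum>a\<in>Poly_Mapping.keys p. if a = a0 then \<Sum>b\<in>Poly_Mapping.keys q.
      if b = b0 then Poly_Mapping.lookup p a0 * Poly_Mapping.lookup q b else 0 else 0)"
    using unique by (intro sum.cong refl) (auto simp: when_def intro!: sum.cong sum.neutral)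
  also have "\<dots> = Poly_Mapping.lookup p a0 * Poly_Mapping.lookup q b0"
    using a0(1) b0(1) by (simp add: good_def)
  also have "\<dots> \<noteq> 0" using a0(1) b0(1) by (simp add: good_def in_keys_iff)
  finally have "a0 + b0 \<in> Poly_Mapping.keys (p * q)" by (simp add: in_keys_iff)
  moreover have "Poly_Mapping.keys (a0 + b0) \<subseteq> A"
    using a0(1) b0(1) by (simp add: keys_add_nat good_def)
  ultimately show ?thesis by (auto simp: linear_prime_iff)
qed

lemma one_notin_linear_prime: "1 \<notin> linear_prime A"
  by (simp add: linear_prime_iff)

section \<open>Prime ideals of the quotient ring\<close>

context mpoly_ideal
begin

lemma quot_cring: "cring (mpoly_ring Quot I)"
  by (rule ideal.quotient_is_cring[OF ideal mpoly_cring])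

lemma primeideal_image:
  assumes P: "ideal P mpoly_ring" and IP: "I \<subseteq> P" and one: "1 \<notin> P"
    and prime: "\<And>p q. p * q \<in> P \<Longrightarrow> p \<in> P \<or> q \<in> P"
  shows "primeideal (cl ` P) (mpoly_ring Quot I)"
proof -
  interpret Q: cring "mpoly_ring Quot I" by (rule quot_cring)
  interpret P: mpoly_ideal P by (rule mpoly_ideal.intro[OF P])
  \<comment> \<open>As \<open>I \<subseteq> P\<close>, membership of a class in the image does not
    depend on the representative.\<close>
  have mem: "cl p \<in> cl ` P \<longleftrightarrow> p \<in> P" for p
  proof
    assume "cl p \<in> cl ` P"
    then obtain q where q: "q \<in> P" "p - q \<in> P" using IP cl_eq_iff by blast
    then show "p \<in> P" using P.ideal_simps(2)[OF q] by simp
  qed simp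
  show ?thesis
  proof (rule primeidealI)
    show "ideal (cl ` P) (mpoly_ring Quot I)"
    proof (rule Q.ideal_closedI)
      fix x r assume "x \<in> cl ` P" "r \<in> carrier (mpoly_ring Quot I)"
      then obtain p q where "x = cl p" "p \<in> P" "r = cl q" by auto
      then show "r \<otimes>\<^bsub>mpoly_ring Quot I\<^esub> x \<in> cl ` P" "x \<otimes>\<^bsub>mpoly_ring Quot I\<^esub> r \<in> cl ` P"
        by simp_all
    next
      fix x y assume "x \<in> cl ` P" "y \<in> cl ` P"
      then obtain p q where "x = cl p" "p \<in> P" "y = cl q" "q \<in> P" by auto
      then show "x \<oplus>\<^bsub>mpoly_ring Quot I\<^esub> y \<in> cl ` P" by simp
    qed auto
    show "carrier (mpoly_ring Quot I) \<noteq> cl ` P"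
      using mem[of 1] one by auto
    fix x y assume "x \<in> carrier (mpoly_ring Quot I)" "y \<in> carrier (mpoly_ring Quot I)"
      "x \<otimes>\<^bsub>mpoly_ring Quot I\<^esub> y \<in> cl ` P"
    moreover from this obtain p q where pq: "x = cl p" "y = cl q" by auto
    ultimately have "p * q \<in> P" using mem[of "p * q"] by simp
    then show "x \<in> cl ` P \<or> y \<in> cl ` P" using prime mem pq by blast
  qed (rule quot_cring)
qed

text \<open>Primality of \<open>P i\<close> turns \<open>cl (f i) \<notin> P i\<close> into the
  nonzerodivisor condition, and since \<open>P k\<close> is proper, the class of 1 serves as the
  vector outside it.\<close>

lemma regular_chain_primes:
  assumes P: "\<And>i. i \<le> k \<Longrightarrow> primeideal (P i) (mpoly_ring Quot I)" "\<And>i. i < k \<Longrightarrow> P i \<subset> P (Suc i)"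
  shows "\<exists>f. regular_chain k P f (cl 1)"
proof -
  have "\<exists>p. cl p \<in> P (Suc i) - P i" if i: "i < k" for i
  proof -
    interpret primeideal "P (Suc i)" "mpoly_ring Quot I" using P(1)[of "Suc i"] i by simp
    have "P (Suc i) \<subseteq> range cl" using a_subset by simp
    then show ?thesis using P(2)[OF i] by blast
  qed
  then obtain f where f: "\<And>i. i < k \<Longrightarrow> cl (f i) \<in> P (Suc i)" "\<And>i. i < k \<Longrightarrow> cl (f i) \<notin> P i"
    by (metis Diff_iff)
  have "regular_chain k P f (cl 1)"
    unfolding regular_chain_def
  proof (intro conjI allI impI ballI)
    fix i assume "i \<le> k"
    interpret primeideal "P i" "mpoly_ring Quot I" using P(1)[OF \<open>i \<le> k\<close>] .
    have sub: "P i \<subseteq> range cl" using a_subset by simp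
    show "submodule mpoly_ring (P i) M"
    proof (rule submoduleI)
      show "\<zero>\<^bsub>M\<^esub> \<in> P i" using additive_subgroup.zero_closed[OF additive_subgroup_axioms] by simp
      fix v w assume v: "v \<in> P i"
      then obtain p where p: "v = cl p" using sub by auto
      show "c \<odot>\<^bsub>M\<^esub> v \<in> P i" for c
        using I_l_closed[OF v, of "cl c"] p by simp
      assume w: "w \<in> P i"
      then obtain q where q: "w = cl q" using sub by auto
      show "v \<oplus>\<^bsub>M\<^esub> w \<in> P i"
        using additive_subgroup.a_closed[OF additive_subgroup_axioms v w] p q by simp
    qed (use sub in simp)
  next
    fix i assume "i < k" then show "P i \<subseteq> P (Suc i)" using P(2) by blast
  next
    fix i w assume i: "i < k" and "w \<in> carrier M"
    then obtain p where p: "w = cl p" by auto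
    show "f i \<odot>\<^bsub>M\<^esub> w \<in> P (Suc i)"
    proof -
      interpret primeideal "P (Suc i)" "mpoly_ring Quot I" using P(1)[of "Suc i"] i by simp
      show ?thesis using I_r_closed[OF f(1)[OF i], of "cl p"] p by simp
    qed
    interpret primeideal "P i" "mpoly_ring Quot I" using P(1)[of i] i by simp
    assume "f i \<odot>\<^bsub>M\<^esub> w \<in> P i"
    then show "w \<in> P i" using I_prime[of "cl (f i)" w] f(2)[OF i] p by simp
  next
    interpret primeideal "P k" "mpoly_ring Quot I" using P(1)[of k] by simp
    show "cl 1 \<notin> P k"
    proof
      assume "cl 1 \<in> P k"
      then have "P k = carrier (mpoly_ring Quot I)" using one_imp_carrier by simp
      then show False using I_notcarr by simp
    qed
  qed simp
  then show ?thesis by (rule exI[of _ f])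
qed

end

section \<open>The Stanley-Reisner complex and the Hilbert function of the quotient\<close>

context monomial_quotient
begin

definition faces :: "'n set set"
  where "faces = {A. \<forall>B\<in>F. \<not> B \<subseteq> A}"

text \<open>Counts vertices, so it is one more than the usual dimension of the complex.
  \<open>faces_nonempty\<close> shows that the maximum is attained for proper
  \<open>I\<close>.\<close>

definition face_dim :: nat
  where "face_dim = Max (card ` faces)"

text \<open>A monomial whose support is not a face lies in \<open>I\<close>, so the classes of the
  other monomials of degree \<open>j\<close> span the component.\<close>

lemma component_dim_le: "component_dim j \<le> card {a :: 'n \<Rightarrow>\<^sub>0 nat. mdeg a = j \<and> Poly_Mapping.keys a \<in> faces}"
proof -
  interpret Gj: vectorspace "ring_of_type_algebra :: 'k ring" "component_space M (G j)"
    by (rule component_vectorspace)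
  let ?E = "{a :: 'n \<Rightarrow>\<^sub>0 nat. mdeg a = j \<and> Poly_Mapping.keys a \<in> faces}"
  let ?g = "\<lambda>a. cl (Poly_Mapping.single a 1)"
  have E: "finite ?E" by (rule finite_subset[OF _ finite_bounded_lookup[of j]]) auto
  have sub: "?g ` ?E \<subseteq> G j"
    using single_homogeneous by (auto simp: quot_grading_def intro!: imageI)
  have subM: "?g ` ?E \<subseteq> carrier M" by auto
  have "G j \<subseteq> kspan (?g ` ?E)"
  proof
    fix v assume "v \<in> G j"
    then obtain p where p: "v = cl p" "p \<in> homogeneous j" by (auto simp: quot_grading_def)
    have "cl (Poly_Mapping.single a (Poly_Mapping.lookup p a)) \<in> kspan (?g ` ?E)" if a: "a \<in> Poly_Mapping.keys p" for a
    proof (cases "Poly_Mapping.keys a \<in> faces")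
      case True
      then have "?g a \<in> kspan (?g ` ?E)"
        using a p(2) kspan_simps(5)[OF subM] by (auto simp: homogeneous_iff)
      then have "const (Poly_Mapping.lookup p a) \<odot>\<^bsub>M\<^esub> ?g a \<in> kspan (?g ` ?E)"
        by (rule kspan_simps(3)[OF subM])
      then show ?thesis by (simp add: const_times_single)
    next
      case False
      then have "Poly_Mapping.single a (Poly_Mapping.lookup p a) \<in> I"
        by (auto simp: I monomial_ideal_def faces_def)
      then have "cl (Poly_Mapping.single a (Poly_Mapping.lookup p a)) = \<zero>\<^bsub>M\<^esub>"
        by (simp add: cl_eq_iff)
      then show ?thesis using kspan_simps(1)[OF subM] by simp
    qed
    then have "(\<Oplus>\<^bsub>M\<^esub>a\<in>Poly_Mapping.keys p. cl (Poly_Mapping.single a (Poly_Mapping.lookup p a))) \<in> kspan (?g ` ?E)"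
      by (intro kspan_finsum subM) auto
    then show "v \<in> kspan (?g ` ?E)"
      using finsum_cl[of "Poly_Mapping.keys p" "\<lambda>a. Poly_Mapping.single a (Poly_Mapping.lookup p a)"] mpoly_expand[of p] p(1) by simp
  qed
  moreover have "kspan (?g ` ?E) \<subseteq> G j" using kspan_mono[OF sub] kspan_component by simp
  ultimately have "Gj.span (?g ` ?E) = G j" using component_span[OF sub] by blast
  then have "component_dim j \<le> card (?g ` ?E)"
    using E sub by (intro Gj.gen_ge_dim) auto
  also have "\<dots> \<le> card ?E" by (rule card_image_le[OF E])
  finally show ?thesis .
qed

text \<open>The exponents are sorted by a face containing their support: there are at most
  \<open>2 ^ n\<close> faces, where \<open>n\<close> is the number of variables, and each accounts
  for at most \<open>Suc J ^ face_dim\<close> exponents.\<close>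

lemma sum_component_dim_le: "(\<Sum>j\<le>J. component_dim j) \<le> 2 ^ card (UNIV :: 'n set) * Suc J ^ face_dim"
proof -
  let ?E = "\<lambda>j. {a :: 'n \<Rightarrow>\<^sub>0 nat. mdeg a = j \<and> Poly_Mapping.keys a \<in> faces}"
  let ?S = "\<lambda>A. {a :: 'n \<Rightarrow>\<^sub>0 nat. mdeg a \<le> J \<and> Poly_Mapping.keys a \<subseteq> A}"
  have fin: "finite (?S A)" for A by (rule finite_subset[OF _ finite_bounded_lookup[of J]]) auto
  have finE: "finite (?E j)" for j by (rule finite_subset[OF _ finite_bounded_lookup[of j]]) auto
  have "(\<Sum>j\<le>J. component_dim j) \<le> (\<Sum>j\<le>J. card (?E j))"
    by (intro sum_mono component_dim_le)
  also have "\<dots> = card (\<Union>j\<le>J. ?E j)"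
    using finE by (intro card_UN_disjoint[symmetric]) auto
  also have "\<dots> \<le> card (\<Union>A\<in>faces. ?S A)"
    using fin by (intro card_mono finite_UN_I) auto
  also have "\<dots> \<le> (\<Sum>A\<in>faces. card (?S A))" by (rule card_UN_le) simp
  also have "\<dots> \<le> (\<Sum>A\<in>faces. Suc J ^ face_dim)"
  proof (rule sum_mono)
    fix A assume "A \<in> faces"
    then have "card A \<le> face_dim" unfolding face_dim_def by (intro Max_ge) auto
    then show "card (?S A) \<le> Suc J ^ face_dim"
      using order_trans[OF card_bounded_support power_increasing[of "card A" face_dim "Suc J"]] by simp
  qed
  also have "\<dots> = card faces * Suc J ^ face_dim" by simp
  also have "\<dots> \<le> 2 ^ card (UNIV :: 'n set) * Suc J ^ face_dim"
  proof (rule mult_right_mono)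
    have "card faces \<le> card (Pow (UNIV :: 'n set))" by (rule card_mono) auto
    then show "card faces \<le> 2 ^ card (UNIV :: 'n set)" by (simp only: card_Pow[OF finite])
  qed simp
  finally show ?thesis .
qed

lemma krull_dim_le: "krull_dim (mpoly_ring Quot I) \<le> enat face_dim"
  unfolding krull_dim_def
proof (rule Sup_least, clarify)
  fix k P assume P: "\<forall>i\<le>k. primeideal (P i) (mpoly_ring Quot I)" "\<forall>i<k. P i \<subset> P (Suc i)"
  then obtain f where "regular_chain k P f (cl 1)" using regular_chain_primes[of k P] by blast
  then show "enat k \<le> enat face_dim"
    using regular_chain_length_le_growth[OF finitely_generated_quot _ sum_component_dim_le] by simp
qed

text \<open>If even the empty set is not a face, then \<open>{} \<in> F\<close> and the ideal
  contains 1.\<close>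

lemma faces_nonempty:
  assumes "I \<noteq> UNIV"
  shows "faces \<noteq> {}"
proof
  assume "faces = {}"
  then have "{} \<notin> faces" by simp
  then have "{} \<in> F" by (auto simp: faces_def)
  then have "I = UNIV" by (auto simp: I monomial_ideal_def)
  then show False using assms by contradiction
qed

text \<open>Removing the vertices of a largest face one at a time puts one more variable into the
  prime at each step.\<close>

lemma krull_dim_ge:
  assumes "I \<noteq> UNIV"
  shows "enat face_dim \<le> krull_dim (mpoly_ring Quot I)"
proof -
  have "face_dim \<in> card ` faces"
    unfolding face_dim_def using faces_nonempty[OF assms] by (intro Max_in) auto
  then obtain A where A: "A \<in> faces" "card A = face_dim" by auto
  obtain e where e: "bij_betw e {..<face_dim} A"
    using ex_bij_betw_nat_finite[of A] A(2) by (auto simp: atLeast0LessThan)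
  let ?A = "\<lambda>i. e ` {i..<face_dim}"
  define P where "P i = cl ` linear_prime (?A i)" for i
  \<comment> \<open>A subset of a face contains no member of \<open>F\<close>, so each monomial of
    \<open>I\<close> involves a variable outside it.\<close>
  have IA: "I \<subseteq> linear_prime (?A i)" for i
  proof -
    have "?A i \<subseteq> A" using e by (auto simp: bij_betw_def)
    then show ?thesis using A(1) unfolding I by (fastforce simp: linear_prime_iff monomial_ideal_def faces_def)
  qed
  have id: "ideal (linear_prime (?A i)) (mpoly_ring :: ('k, 'n) mpoly ring)" for i
    unfolding linear_prime_def by (rule ideal_monomial_ideal)
  have prime: "primeideal (P i) (mpoly_ring Quot I)" for i
    unfolding P_def by (rule primeideal_image[OF id IA one_notin_linear_prime]) (use linear_prime_mult in blast)
  have "P i \<subset> P (Suc i)" if i: "i < face_dim" for i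
  proof
    have "linear_prime (?A i) \<subseteq> linear_prime (?A (Suc i))"
      by (fastforce simp: linear_prime_iff)
    then show "P i \<subseteq> P (Suc i)" unfolding P_def by (rule image_mono)
    \<comment> \<open>The variable removed at step \<open>i\<close> separates the two consecutive
      primes.\<close>
    define x :: "('k, 'n) mpoly" where "x = var (e i)"
    have keys_var: "Poly_Mapping.keys x = {Poly_Mapping.single (e i) (1 :: nat)}"
      by (simp add: x_def var_def)
    have "e j \<noteq> e i" if "j \<in> {Suc i..<face_dim}" for j
      using inj_onD[OF bij_betw_imp_inj_on[OF e], of j i] that i by auto
    then have "e i \<notin> ?A (Suc i)" by force
    then have "x \<in> linear_prime (?A (Suc i))" by (simp add: linear_prime_iff keys_var)
    then have "cl x \<in> P (Suc i)" by (simp add: P_def)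
    moreover have "x \<notin> linear_prime (?A i)" using i by (simp add: linear_prime_iff keys_var)
    have "cl x \<notin> P i"
    proof
      interpret L: mpoly_ideal "linear_prime (?A i) :: ('k, 'n) mpoly set" by (rule mpoly_ideal.intro[OF id])
      assume "cl x \<in> P i"
      then obtain p where p: "p \<in> linear_prime (?A i)" "cl x = cl p" unfolding P_def by blast
      then have "x - p \<in> linear_prime (?A i)" using IA cl_eq_iff by blast
      with p(1) have "p + (x - p) \<in> linear_prime (?A i)" by (rule L.ideal_simps(2))
      then show False using \<open>x \<notin> linear_prime (?A i)\<close> by simp
    qed
    ultimately show "P i \<noteq> P (Suc i)" by blast
  qed
  then show ?thesis
    unfolding krull_dim_def using prime by (intro Sup_upper) blast
qed

text \<open>A nonzero ideal forces a member of \<open>F\<close>, so the set of all variables is not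
  a face and a largest face misses some variable.\<close>

lemma face_dim_less:
  assumes "I \<noteq> UNIV" "I \<noteq> {0}"
  shows "face_dim < card (UNIV :: 'n set)"
proof -
  obtain p where p: "p \<in> I" "p \<noteq> 0" using assms(2) ideal_simps(1) by blast
  then obtain a where "a \<in> Poly_Mapping.keys p" by fastforce
  then obtain B where "B \<in> F" using p(1) by (auto simp: I monomial_ideal_def)
  then have "UNIV \<notin> faces" by (auto simp: faces_def)
  have "face_dim \<in> card ` faces"
    unfolding face_dim_def using faces_nonempty[OF assms(1)] by (intro Max_in) auto
  then obtain A where "A \<in> faces" "card A = face_dim" by auto
  moreover from this have "A \<subset> UNIV" using \<open>UNIV \<notin> faces\<close> by auto
  ultimately show ?thesis using psubset_card_mono[of UNIV A] by simp
qed

end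

section \<open>Depth and Hilbert depth\<close>

text \<open>The last conjunct of \<open>regular_sequence\<close> supplies the vector outside the
  final submodule.\<close>

lemma (in graded_poly_module) regular_sequence_chain:
  assumes xs: "regular_sequence M xs"
  shows "\<exists>v. regular_chain (length xs) (\<lambda>i. ideal_smult (set (take i xs)) M) (\<lambda>i. xs ! i) v"
proof -
  let ?gen = "\<lambda>A. {a \<odot>\<^bsub>M\<^esub> v | a v. a \<in> A \<and> v \<in> carrier M}"
  have gen: "?gen A \<subseteq> carrier M" for A by auto
  have sub: "ideal_smult A M \<subseteq> carrier M" for A
    unfolding ideal_smult_def by (rule span_is_subset2[OF gen])
  then obtain v where v: "v \<in> carrier M" "v \<notin> ideal_smult (set xs) M"
    using xs unfolding regular_sequence_def by blast
  have "regular_chain (length xs) (\<lambda>i. ideal_smult (set (take i xs)) M) (\<lambda>i. xs ! i) v"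
    unfolding regular_chain_def
  proof (intro conjI allI impI ballI)
    fix i
    show "submodule mpoly_ring (ideal_smult (set (take i xs)) M) M"
      unfolding ideal_smult_def by (rule span_is_submodule[OF gen])
    assume i: "i < length xs"
    have "?gen (set (take i xs)) \<subseteq> ?gen (set (take (Suc i) xs))"
      using subsetD[OF set_take_subset_set_take[of i "Suc i" xs]] by (intro Collect_mono) auto
    then show "ideal_smult (set (take i xs)) M \<subseteq> ideal_smult (set (take (Suc i) xs)) M"
      unfolding ideal_smult_def by (rule span_is_monotone)
    fix w assume w: "w \<in> carrier M"
    show "xs ! i \<odot>\<^bsub>M\<^esub> w \<in> ideal_smult (set (take i xs)) M \<Longrightarrow> w \<in> ideal_smult (set (take i xs)) M"
      using xs i w unfolding regular_sequence_def by blast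
    have "xs ! i \<in> set (take (Suc i) xs)" using i by (simp add: take_Suc_conv_app_nth)
    then have "xs ! i \<odot>\<^bsub>M\<^esub> w \<in> ?gen (set (take (Suc i) xs))" using w by blast
    then show "xs ! i \<odot>\<^bsub>M\<^esub> w \<in> ideal_smult (set (take (Suc i) xs)) M"
      unfolding ideal_smult_def using in_own_span[OF gen] by blast
  qed (use v in simp_all)
  then show ?thesis by (rule exI[of _ v])
qed

lemma (in graded_poly_module) depth_le_growth:
  assumes "finitely_generated M" and "\<And>J. (\<Sum>j\<le>J. component_dim j) \<le> C * Suc J ^ d"
  shows "depth M \<le> enat d"
  unfolding depth_def
proof (rule Sup_least, clarify)
  fix xs assume "regular_sequence M xs"
  then obtain v where "regular_chain (length xs) (\<lambda>i. ideal_smult (set (take i xs)) M) (\<lambda>i. xs ! i) v"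
    using regular_sequence_chain by blast
  then show "enat (length xs) \<le> enat d"
    using regular_chain_length_le_growth[OF assms(1) _ assms(2)] by simp
qed

text \<open>
  \<open>hdepth\<close> only ranges over modules with carrier in \<open>(nat \<Rightarrow> S) set\<close>, so \<open>S/I\<close> itself is not among its
  competitors and has to be moved there.
\<close>

definition transport :: "('a \<Rightarrow> 'b) \<Rightarrow> ('b \<Rightarrow> 'a) \<Rightarrow> ('r, 'a) module \<Rightarrow> ('r, 'b) module"
  where "transport \<phi> \<psi> M =
    \<lparr>carrier = \<phi> ` carrier M, monoid.mult = (\<lambda>x y. \<phi> (\<psi> x \<otimes>\<^bsub>M\<^esub> \<psi> y)), one = \<phi> \<one>\<^bsub>M\<^esub>,
     ring.zero = \<phi> \<zero>\<^bsub>M\<^esub>, add = (\<lambda>x y. \<phi> (\<psi> x \<oplus>\<^bsub>M\<^esub> \<psi> y)), module.smult = (\<lambda>c x. \<phi> (c \<odot>\<^bsub>M\<^esub> \<psi> x))\<rparr>"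

lemma component_space_transport:
  "component_space (transport \<phi> \<psi> M) (\<phi> ` V) = transport \<phi> \<psi> (component_space M V)"
  by (simp add: transport_def component_space_def)

text \<open>A left inverse makes \<open>\<phi>\<close> injective but not onto, so the target type
  may be larger; the copy of the module lives on the image of \<open>\<phi>\<close>.\<close>

locale module_transport = Module.module R M
  for R :: "'r ring" and M :: "('r, 'a) module" (structure) +
  fixes \<phi> :: "'a \<Rightarrow> 'b" and \<psi> :: "'b \<Rightarrow> 'a"
  assumes inverse [simp]: "\<psi> (\<phi> x) = x"
begin

abbreviation T :: "('r, 'b) module"
  where "T \<equiv> transport \<phi> \<psi> M"

lemma \<phi>_eq_iff [simp]: "\<phi> x = \<phi> y \<longleftrightarrow> x = y"
  by (metis inverse)

lemma \<phi>_image_iff [simp]: "\<phi> x \<in> \<phi> ` A \<longleftrightarrow> x \<in> A"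
  by auto

lemma transport_simps [simp]:
  "carrier T = \<phi> ` carrier M" "\<zero>\<^bsub>T\<^esub> = \<phi> \<zero>\<^bsub>M\<^esub>" "\<phi> x \<oplus>\<^bsub>T\<^esub> \<phi> y = \<phi> (x \<oplus>\<^bsub>M\<^esub> y)" "c \<odot>\<^bsub>T\<^esub> \<phi> x = \<phi> (c \<odot>\<^bsub>M\<^esub> x)"
  by (simp_all add: transport_def)

lemma module_transport: "Module.module R T"
proof (rule module_criteria)
  show "\<forall>v\<in>carrier T. \<exists>w\<in>carrier T. v \<oplus>\<^bsub>T\<^esub> w = \<zero>\<^bsub>T\<^esub>"
  proof
    fix v assume "v \<in> carrier T"
    then obtain x where "v = \<phi> x" "x \<in> carrier M" by auto
    then show "\<exists>w\<in>carrier T. v \<oplus>\<^bsub>T\<^esub> w = \<zero>\<^bsub>T\<^esub>" by (intro bexI[of _ "\<phi> (\<ominus>\<^bsub>M\<^esub> x)"]) (auto simp: M.r_neg)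
  qed
qed (auto simp: R.is_cring M.a_ac smult_l_distr smult_r_distr smult_assoc1)

sublocale hom: mod_hom R M T \<phi>
  using module_axioms module_transport
  by (simp add: mod_hom_def mod_hom_axioms_def module_hom_def)

text \<open>The homomorphism rules push \<open>\<phi>\<close> inward, against the direction of
  \<open>transport_simps\<close>, whose normal form is \<open>\<phi>\<close> applied to an element
  of \<open>M\<close>.\<close>

declare hom.f0_is_0 [simp del] hom.f_add [simp del] hom.f_smult [simp del]

text \<open>Each inclusion follows from minimality of a span, since images and preimages of
  submodules under \<open>\<phi>\<close> are submodules.\<close>

lemma span_transport:
  assumes "A \<subseteq> carrier M"
  shows "hom.N.span (\<phi> ` A) = \<phi> ` span A"
proof
  interpret sp: submodule R "span A" M by (rule span_is_submodule[OF assms])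
  have "submodule R (\<phi> ` span A) T"
  proof
    show "\<phi> ` span A \<subseteq> carrier T" using sp.subset by auto
    show "\<zero>\<^bsub>T\<^esub> \<in> \<phi> ` span A" by simp
    fix v assume "v \<in> \<phi> ` span A"
    then obtain x where x: "v = \<phi> x" "x \<in> span A" by blast
    show "c \<odot>\<^bsub>T\<^esub> v \<in> \<phi> ` span A" if "c \<in> carrier R" for c
      using sp.smult_closed[OF that x(2)] x(1) by simp
    fix w assume "w \<in> \<phi> ` span A"
    then obtain y where y: "w = \<phi> y" "y \<in> span A" by blast
    show "v \<oplus>\<^bsub>T\<^esub> w \<in> \<phi> ` span A"
      using sp.m_closed[OF x(2) y(2)] x(1) y(1) by simp
  qed
  then show "hom.N.span (\<phi> ` A) \<subseteq> \<phi> ` span A"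
    by (intro hom.N.span_is_subset image_mono in_own_span[OF assms])
  have A: "\<phi> ` A \<subseteq> carrier T" using assms by auto
  interpret sT: submodule R "hom.N.span (\<phi> ` A)" T by (rule hom.N.span_is_submodule[OF A])
  let ?B = "{v \<in> carrier M. \<phi> v \<in> hom.N.span (\<phi> ` A)}"
  have "submodule R ?B M"
  proof
    show "v \<oplus>\<^bsub>M\<^esub> w \<in> ?B" if "v \<in> ?B" "w \<in> ?B" for v w
      using that sT.m_closed[of "\<phi> v" "\<phi> w"] by simp
    show "\<zero>\<^bsub>M\<^esub> \<in> ?B" using sT.zero_closed by simp
    show "c \<odot>\<^bsub>M\<^esub> v \<in> ?B" if "c \<in> carrier R" "v \<in> ?B" for c v
      using that sT.smult_closed[of c "\<phi> v"] by simp
  qed auto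
  moreover have "A \<subseteq> ?B" using assms hom.N.in_own_span[OF A] by auto
  ultimately have "span A \<subseteq> ?B" by (intro span_is_subset)
  then show "\<phi> ` span A \<subseteq> hom.N.span (\<phi> ` A)" by auto
qed

end

lemma dim_transport:
  fixes K :: "'r ring" and V :: "('r, 'a) module" and \<phi> :: "'a \<Rightarrow> 'b"
  assumes V: "vectorspace K V" and fd: "vectorspace.fin_dim K V" and inv: "\<And>x. \<psi> (\<phi> x) = x"
  shows "vectorspace.dim K (transport \<phi> \<psi> V) = vectorspace.dim K V"
proof -
  interpret V: vectorspace K V by (rule V)
  interpret module_transport K V \<phi> \<psi> by unfold_locales (rule inv)
  have W: "vectorspace K T" using module_transport V.field_axioms by (simp add: vectorspace_def)
  have "linear_map K V T \<phi>" using V W hom.mod_hom_axioms by (simp add: linear_map_def mod_hom_def)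
  then interpret linear_map K V T \<phi> .
  show ?thesis by (rule dim_eq[OF fd, symmetric]) (auto simp: inj_on_def)
qed

context graded_poly_module
begin

context
  fixes \<phi> :: "'m \<Rightarrow> 'b" and \<psi> :: "'b \<Rightarrow> 'm"
  assumes inv: "\<And>x. \<psi> (\<phi> x) = x"
begin

interpretation tr: module_transport mpoly_ring M \<phi> \<psi>
  by unfold_locales (rule inv)

declare tr.hom.f0_is_0 [simp del] tr.hom.f_add [simp del] tr.hom.f_smult [simp del]

lemma finitely_generated_transport:
  assumes "finitely_generated M"
  shows "finitely_generated (transport \<phi> \<psi> M)"
proof -
  obtain A where A: "finite A" "A \<subseteq> carrier M" "span A = carrier M"
    using assms unfolding finitely_generated_def by blast
  then show ?thesis unfolding finitely_generated_def
    using tr.span_transport[OF A(2)] by (intro exI[of _ "\<phi> ` A"]) auto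
qed

lemma hilbert_series_transport:
  assumes "finitely_generated M"
  shows "hilbert_series (transport \<phi> \<psi> M) (\<lambda>j. \<phi> ` G j) = hilbert_series M G"
  unfolding hilbert_series_def component_space_transport
  by (simp add: dim_transport[where \<phi> = \<phi> and \<psi> = \<psi>, OF component_vectorspace component_fin_dim[OF assms] inv])

lemma ideal_smult_transport: "ideal_smult A (transport \<phi> \<psi> M) = \<phi> ` ideal_smult A M"
proof -
  have "{a \<odot>\<^bsub>tr.T\<^esub> v | a v. a \<in> A \<and> v \<in> carrier tr.T} = \<phi> ` {a \<odot>\<^bsub>M\<^esub> v | a v. a \<in> A \<and> v \<in> carrier M}" (is "?L = ?R")
  proof (intro equalityI subsetI)
    fix x assume "x \<in> ?L"
    then obtain a v where x: "x = a \<odot>\<^bsub>tr.T\<^esub> v" "a \<in> A" "v \<in> carrier tr.T" by blast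
    then obtain w where w: "v = \<phi> w" "w \<in> carrier M" by auto
    show "x \<in> ?R" unfolding x(1) w(1) tr.transport_simps using x(2) w(2) by blast
  next
    fix x assume "x \<in> ?R"
    then obtain a w where x: "a \<in> A" "w \<in> carrier M" "x = \<phi> (a \<odot>\<^bsub>M\<^esub> w)" by blast
    then have "x = a \<odot>\<^bsub>tr.T\<^esub> \<phi> w" "\<phi> w \<in> carrier tr.T" by simp_all
    then show "x \<in> ?L" by (intro CollectI exI[of _ a] exI[of _ "\<phi> w"] conjI x(1))
  qed
  then show ?thesis unfolding ideal_smult_def by (simp only:) (rule tr.span_transport, auto)
qed

text \<open>The same list stays regular after transport, because \<open>ideal_smult\<close> commutes
  with \<open>\<phi>\<close>.\<close>

lemma depth_transport: "depth M \<le> depth (transport \<phi> \<psi> M)"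
  unfolding depth_def
proof (rule Sup_subset_mono, clarify)
  fix xs assume xs: "set xs \<subseteq> max_ideal" "regular_sequence M xs"
  have "regular_sequence tr.T xs"
    unfolding regular_sequence_def ideal_smult_transport
  proof (intro conjI allI impI ballI)
    fix i v assume i: "i < length xs" and "v \<in> carrier tr.T"
    then obtain w where w: "v = \<phi> w" "w \<in> carrier M" by auto
    assume "xs ! i \<odot>\<^bsub>tr.T\<^esub> v \<in> \<phi> ` ideal_smult (set (take i xs)) M"
    then have "xs ! i \<odot>\<^bsub>M\<^esub> w \<in> ideal_smult (set (take i xs)) M"
      unfolding w(1) by simp
    then have "w \<in> ideal_smult (set (take i xs)) M"
      using xs(2) i w(2) unfolding regular_sequence_def by blast
    then show "v \<in> \<phi> ` ideal_smult (set (take i xs)) M" unfolding w(1) by simp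
  next
    have "inj \<phi>" by (rule injI) simp
    then show "\<phi> ` ideal_smult (set xs) M \<noteq> carrier tr.T"
      using xs(2) by (simp add: regular_sequence_def inj_image_eq_iff)
  qed
  then show "\<exists>ys. enat (length xs) = enat (length ys) \<and> set ys \<subseteq> max_ideal \<and> regular_sequence tr.T ys"
    using xs(1) by blast
qed

lemma graded_transport: "graded_module (transport \<phi> \<psi> M) (\<lambda>j. \<phi> ` G j)"
  unfolding graded_module_def
proof (intro conjI allI ballI)
  show "Module.module mpoly_ring tr.T" by (rule tr.module_transport)
next
  fix j
  show "subgroup (\<phi> ` G j) (add_monoid tr.T)"
  proof (rule group.subgroupI[OF tr.hom.N.M.a_group])
    show "\<phi> ` G j \<noteq> {}" using component_simps(1)[of j] by blast
    fix v assume "v \<in> \<phi> ` G j"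
    then obtain x where x: "v = \<phi> x" "x \<in> G j" by auto
    have "\<ominus>\<^bsub>M\<^esub> x \<in> G j"
      using subgroup.m_inv_closed[OF component_subgroup x(2)] by (simp add: a_inv_def)
    moreover have "\<ominus>\<^bsub>tr.T\<^esub> \<phi> x = \<phi> (\<ominus>\<^bsub>M\<^esub> x)" using tr.hom.f_neg[of x] x(2) by simp
    ultimately have "\<ominus>\<^bsub>tr.T\<^esub> v \<in> \<phi> ` G j" unfolding x(1) by simp
    then show "inv\<^bsub>add_monoid tr.T\<^esub> v \<in> \<phi> ` G j" by (simp only: a_inv_def)
    fix w assume "w \<in> \<phi> ` G j"
    then show "v \<otimes>\<^bsub>add_monoid tr.T\<^esub> w \<in> \<phi> ` G j" using x by auto
  qed auto
next
  fix v assume "v \<in> carrier tr.T"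
  then obtain x where x: "v = \<phi> x" "x \<in> carrier M" by auto
  let ?P = "\<lambda>f. (\<forall>j. f j \<in> G j) \<and> finite {j. f j \<noteq> \<zero>\<^bsub>M\<^esub>} \<and> x = (\<Oplus>\<^bsub>M\<^esub>j\<in>{j. f j \<noteq> \<zero>\<^bsub>M\<^esub>}. f j)"
  let ?Q = "\<lambda>g. (\<forall>j. g j \<in> \<phi> ` G j) \<and> finite {j. g j \<noteq> \<zero>\<^bsub>tr.T\<^esub>} \<and> v = (\<Oplus>\<^bsub>tr.T\<^esub>j\<in>{j. g j \<noteq> \<zero>\<^bsub>tr.T\<^esub>}. g j)"
  have sum: "(\<Oplus>\<^bsub>tr.T\<^esub>j\<in>S. \<phi> (f j)) = \<phi> (finsum M f S)" if "finite S" "\<And>j. f j \<in> carrier M" for f :: "nat \<Rightarrow> 'm" and S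
    using that(1) by (induction S rule: finite_induct) (use that(2) in \<open>auto simp: tr.hom.N.M.finsum_insert\<close>)
  \<comment> \<open>Composition with \<open>\<phi>\<close> matches decompositions of
    \<open>x\<close> in \<open>M\<close> with decompositions of \<open>v\<close> in the
    copy.\<close>
  have PQ: "?P f \<longleftrightarrow> ?Q (\<lambda>j. \<phi> (f j))" for f
  proof (cases "(\<forall>j. f j \<in> G j) \<and> finite {j. f j \<noteq> \<zero>\<^bsub>M\<^esub>}")
    case True
    then have "f j \<in> carrier M" for j using component_subset by blast
    with True have "(\<Oplus>\<^bsub>tr.T\<^esub>j\<in>{j. f j \<noteq> \<zero>\<^bsub>M\<^esub>}. \<phi> (f j)) = \<phi> (\<Oplus>\<^bsub>M\<^esub>j\<in>{j. f j \<noteq> \<zero>\<^bsub>M\<^esub>}. f j)"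
      by (intro sum) auto
    then show ?thesis using True x(1) by simp
  qed auto
  have "\<exists>!f. ?P f" using graded x(2) unfolding graded_module_def by blast
  then obtain f where f: "?P f" "\<And>g. ?P g \<Longrightarrow> g = f" by blast
  show "\<exists>!g. ?Q g"
  proof (rule ex1I[of _ "\<lambda>j. \<phi> (f j)"])
    show "?Q (\<lambda>j. \<phi> (f j))" using f(1) PQ by blast
    fix g assume g: "?Q g"
    \<comment> \<open>All values of \<open>g\<close> lie in the image of \<open>\<phi>\<close>, so
      \<open>g\<close> arises from a family in \<open>M\<close> and uniqueness there
      applies.\<close>
    have eq: "g = (\<lambda>j. \<phi> (\<psi> (g j)))"
    proof
      fix j
      have "g j \<in> \<phi> ` G j" using g by blast
      then show "g j = \<phi> (\<psi> (g j))" using inv by auto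
    qed
    have "?Q (\<lambda>j. \<phi> (\<psi> (g j)))" by (rule back_subst[of ?Q, OF g eq])
    then have "?P (\<lambda>j. \<psi> (g j))" by (rule iffD2[OF PQ])
    then have "(\<lambda>j. \<psi> (g j)) = f" by (rule f(2))
    then show "g = (\<lambda>j. \<phi> (f j))" using eq by metis
  qed
next
  fix i j v and p :: "('k, 'n) mpoly"
  assume "p \<in> homogeneous i" "v \<in> \<phi> ` G j"
  then show "p \<odot>\<^bsub>tr.T\<^esub> v \<in> \<phi> ` G (i + j)" using component_smult by auto
qed

end

end

section \<open>Comparison of depth, Hilbert depth and Krull dimension\<close>

theorem theorem2p4:
  fixes I :: "('k::field, 'n::finite) mpoly set"
  assumes "infinite (UNIV :: 'k set)"
    and "squarefree_monomial_ideal I"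
    and "I \<noteq> UNIV"
  shows "depth (quot_module I) \<le> hdepth (quot_module I) (quot_grading I) \<and>
    hdepth (quot_module I) (quot_grading I) \<le> krull_dim (mpoly_ring Quot I) \<and>
    (I \<noteq> {0} \<longrightarrow> krull_dim (mpoly_ring Quot I) \<le> enat (card (UNIV :: 'n set) - 1))"
proof -
  obtain F :: "'n set set" where "I = Idl\<^bsub>mpoly_ring\<^esub> ((\<lambda>A. \<Prod>i\<in>A. var i) ` F)"
    using assms(2) unfolding squarefree_monomial_ideal_def by blast
  then interpret monomial_quotient F I by unfold_locales (simp only: Idl_monomials)
  \<comment> \<open>A coset is represented by the constant functions with values in it; evaluation
    at 0 recovers the coset.\<close>
  define \<phi> :: "('k, 'n) mpoly set \<Rightarrow> (nat \<Rightarrow> ('k, 'n) mpoly) set" where "\<phi> C = (\<lambda>p _. p) ` C" for C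
  define \<psi> :: "(nat \<Rightarrow> ('k, 'n) mpoly) set \<Rightarrow> ('k, 'n) mpoly set" where "\<psi> D = (\<lambda>g. g 0) ` D" for D
  have inv: "\<psi> (\<phi> C) = C" for C by (simp add: \<phi>_def \<psi>_def image_image)
  have "depth M \<le> depth (transport \<phi> \<psi> M)" by (rule depth_transport[where \<phi> = \<phi> and \<psi> = \<psi>, OF inv])
  also have "\<dots> \<le> hdepth M G"
    unfolding hdepth_def
    using graded_transport[where \<phi> = \<phi> and \<psi> = \<psi>, OF inv] finitely_generated_transport[where \<phi> = \<phi> and \<psi> = \<psi>, OF inv finitely_generated_quot]
      hilbert_series_transport[where \<phi> = \<phi> and \<psi> = \<psi>, OF inv finitely_generated_quot]
    by (intro Sup_upper) blast
  finally have 1: "depth M \<le> hdepth M G" .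
  have "hdepth M G \<le> enat face_dim"
    unfolding hdepth_def
  proof (rule Sup_least, clarify)
    fix N :: "(('k, 'n) mpoly, (nat \<Rightarrow> ('k, 'n) mpoly) set) module" and H
    assume N: "graded_module N H" "finitely_generated N" "hilbert_series N H = hilbert_series M G"
    interpret N: graded_poly_module N H
      using N(1) by (simp add: graded_poly_module_def graded_poly_module_axioms_def poly_module_def graded_module_def)
    \<comment> \<open>The growth bound depends only on the dimensions of the components, so it
      passes from S/I to every competitor with the same Hilbert series.\<close>
    have "N.component_dim j = component_dim j" for j
      using arg_cong[OF N(3), of "\<lambda>f. fps_nth f j"] by (simp add: hilbert_series_def)
    then have "(\<Sum>j\<le>J. N.component_dim j) \<le> 2 ^ card (UNIV :: 'n set) * Suc J ^ face_dim" for J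
      using sum_component_dim_le by simp
    then show "depth N \<le> enat face_dim" by (rule N.depth_le_growth[OF N(2)])
  qed
  also have "\<dots> \<le> krull_dim (mpoly_ring Quot I)" by (rule krull_dim_ge[OF assms(3)])
  finally have 2: "hdepth M G \<le> krull_dim (mpoly_ring Quot I)" .
  \<comment> \<open>The subtraction does not truncate: \<open>face_dim_less\<close> makes the number
    of variables positive.\<close>
  have 3: "krull_dim (mpoly_ring Quot I) \<le> enat (card (UNIV :: 'n set) - 1)" if "I \<noteq> {0}"
    using face_dim_less[OF assms(3) that] by (intro order_trans[OF krull_dim_le]) simp
  show ?thesis using 1 2 3 by blast
qed

end
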